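(* Let $\theta(z)$ and $\varphi(w)$ be two nonconstant inner functions on the unit disk, let $M$ be a submodule of $H^2(\mathbb{D}^2)$, and let $M_{\theta,\varphi}=[C_{\theta,\varphi}M]$ be the smallest submodule of $H^2(\mathbb{D}^2)$ containing $C_{\theta,\varphi}M$. Let $K^M_{\lambda,\mu}(z,w)$ and $K^{M_{\theta,\varphi}}_{\lambda,\mu}(z,w)$ be the reproducing kernels of $M$ and $M_{\theta,\varphi}$, respectively. Then for all $(\lambda,\mu),(z,w)\in\mathbb{D}^2$, $$K^{M_{\theta,\varphi}}_{\lambda,\mu}(z,w)=\frac{1-\overline{\theta(\lambda)}\theta(z)}{1-\bar{\lambda}z}\cdot\frac{1-\overline{\varphi(\mu)}\varphi(w)}{1-\bar{\mu}w}\cdot K^{M}_{\theta(\lambda),\varphi(\mu)}(\theta(z),\varphi(w)).$$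
   Context: $\mathbb{D}$ is the open unit disk in $\mathbb{C}$, and $H^2(\mathbb{D}^2)$ is the Hardy space over the bidisk, with reproducing (Szegő) kernel $\frac{1}{(1-\bar\lambda z)(1-\bar\mu w)}$. A submodule of $H^2(\mathbb{D}^2)$ is a closed subspace invariant under multiplication by the coordinate functions $z$ and $w$. For $X\subset H^2(\mathbb{D}^2)$, $[X]$ denotes the submodule generated by $X$, i.e. the norm closure of the linear span of $\mathbb{C}[z,w]\cdot X$. The composition operator $C_{\theta,\varphi}$ is $C_{\theta,\varphi}f(z,w)=f(\theta(z),\varphi(w))$; it maps $H^2(\mathbb{D}^2)$ boundedly into itself. The reproducing kernel of a closed subspace $M$ (with the norm of $H^2(\mathbb{D}^2)$) is the function with $K^M_{\lambda,\mu}\in M$ and $\langle f,K^M_{\lambda,\mu}\rangle=f(\lambda,\mu)$ for all $f\in M$, $(\lambda,\mu)\in\mathbb{D}^2$. An inner function is a bounded analytic function on $\mathbb{D}$ whose boundary values have modulus 1 almost everywhere. *)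

theory Defs
  imports "HOL-Complex_Analysis.Complex_Analysis"
begin

abbreviation disk :: "complex set" where
  "disk \<equiv> ball 0 1"

abbreviation bidisk :: "(complex \<times> complex) set" where
  "bidisk \<equiv> disk \<times> disk"

text \<open>A function on the bidisk is represented by the total function that is 0 outside the bidisk,
  so that equality of functions on the bidisk is equality in HOL.\<close>

definition hardy2 :: "(complex \<times> complex \<Rightarrow> complex) set" where
  "hardy2 = {f. (\<exists>a. (\<lambda>(m, n). (cmod (a m n))\<^sup>2) summable_on (UNIV :: (nat \<times> nat) set) \<and>
                     (\<forall>z\<in>disk. \<forall>w\<in>disk. ((\<lambda>(m, n). a m n * z ^ m * w ^ n) has_sum f (z, w)) UNIV)) \<and>
                (\<forall>p. p \<notin> bidisk \<longrightarrow> f p = 0)}"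

text \<open>The Taylor coefficient of \<open>z\<^sup>m w\<^sup>n\<close> at the origin.\<close>

definition taylor_coeff :: "(complex \<times> complex \<Rightarrow> complex) \<Rightarrow> nat \<Rightarrow> nat \<Rightarrow> complex" where
  "taylor_coeff f m n =
     (deriv ^^ m) (\<lambda>z. (deriv ^^ n) (\<lambda>w. f (z, w)) 0) 0 / (fact m * fact n)"

definition h2_inner ::
  "(complex \<times> complex \<Rightarrow> complex) \<Rightarrow> (complex \<times> complex \<Rightarrow> complex) \<Rightarrow> complex" where
  "h2_inner f g = (\<Sum>\<^sub>\<infinity>(m, n)\<in>UNIV. taylor_coeff f m n * cnj (taylor_coeff g m n))"

definition h2_norm :: "(complex \<times> complex \<Rightarrow> complex) \<Rightarrow> real" where
  "h2_norm f = sqrt (Re (h2_inner f f))"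

text \<open>Norm closure of a set \<open>X \<subseteq> hardy2\<close>.\<close>

definition h2_closure ::
  "(complex \<times> complex \<Rightarrow> complex) set \<Rightarrow> (complex \<times> complex \<Rightarrow> complex) set" where
  "h2_closure X = {f \<in> hardy2. \<forall>e>0. \<exists>g\<in>X. h2_norm (\<lambda>p. f p - g p) < e}"

definition h2_closed_subspace :: "(complex \<times> complex \<Rightarrow> complex) set \<Rightarrow> bool" where
  "h2_closed_subspace M \<longleftrightarrow>
     M \<subseteq> hardy2 \<and>
     (\<lambda>p. 0) \<in> M \<and>
     (\<forall>f\<in>M. \<forall>g\<in>M. (\<lambda>p. f p + g p) \<in> M) \<and>
     (\<forall>c. \<forall>f\<in>M. (\<lambda>p. c * f p) \<in> M) \<and>
     h2_closure M \<subseteq> M"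

definition h2_submodule :: "(complex \<times> complex \<Rightarrow> complex) set \<Rightarrow> bool" where
  "h2_submodule M \<longleftrightarrow>
     h2_closed_subspace M \<and>
     (\<forall>f\<in>M. (\<lambda>(z, w). z * f (z, w)) \<in> M) \<and>
     (\<forall>f\<in>M. (\<lambda>(z, w). w * f (z, w)) \<in> M)"

definition bipolys :: "(complex \<times> complex \<Rightarrow> complex) set" where
  "bipolys = {q. \<exists>d (c :: nat \<Rightarrow> nat \<Rightarrow> complex).
                   q = (\<lambda>(z, w). \<Sum>i\<le>d. \<Sum>j\<le>d. c i j * z ^ i * w ^ j)}"

text \<open>The linear span of the products \<open>q f\<close> with \<open>q\<close> a polynomial and \<open>f \<in> X\<close>; scalars
  are absorbed into the polynomials.\<close>

definition poly_span ::
  "(complex \<times> complex \<Rightarrow> complex) set \<Rightarrow> (complex \<times> complex \<Rightarrow> complex) set" where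
  "poly_span X = {g. \<exists>(N :: nat) q f. (\<forall>k<N. q k \<in> bipolys \<and> f k \<in> X) \<and>
                                      g = (\<lambda>p. \<Sum>k<N. q k p * f k p)}"

definition generated_submodule ::
  "(complex \<times> complex \<Rightarrow> complex) set \<Rightarrow> (complex \<times> complex \<Rightarrow> complex) set" where
  "generated_submodule X = h2_closure (poly_span X)"

definition comp_op :: "(complex \<Rightarrow> complex) \<Rightarrow> (complex \<Rightarrow> complex) \<Rightarrow>
    (complex \<times> complex \<Rightarrow> complex) \<Rightarrow> (complex \<times> complex \<Rightarrow> complex)" where
  "comp_op \<theta> \<phi> f = (\<lambda>(z, w). if (z, w) \<in> bidisk then f (\<theta> z, \<phi> w) else 0)"

definition reproducing_kernel :: "(complex \<times> complex \<Rightarrow> complex) set \<Rightarrow>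
    (complex \<times> complex \<Rightarrow> complex \<times> complex \<Rightarrow> complex) \<Rightarrow> bool" where
  "reproducing_kernel M K \<longleftrightarrow>
     (\<forall>p\<in>bidisk. K p \<in> M \<and> (\<forall>f\<in>M. h2_inner f (K p) = f p))"

text \<open>Boundary values are radial limits. By Fatou's theorem they exist almost everywhere for every
  bounded analytic function on the disk, so demanding their existence is no restriction.\<close>

definition inner_function :: "(complex \<Rightarrow> complex) \<Rightarrow> bool" where
  "inner_function \<theta> \<longleftrightarrow>
     \<theta> holomorphic_on disk \<and>
     bounded (\<theta> ` disk) \<and>
     (AE t\<in>{0..2 * pi} in lborel.
        \<exists>b. ((\<lambda>r. \<theta> (of_real r * cis t)) \<longlongrightarrow> b) (at_left 1) \<and> cmod b = 1)"

end

theory Submission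
  imports Defs
begin

text \<open>
  For an inner function \<theta> write \<open>k\<^sub>a(z) = (1 - cnj (\<theta> a) * \<theta> z) / (1 - cnj a * z)\<close>, the
  reproducing kernel of the model space orthogonal to \<open>\<theta> H\<^sup>2\<close>. The whole proof rests on
  the orthogonality relation \<open>\<langle>\<theta>\<^sup>m k\<^sub>a, \<theta>\<^sup>n k\<^sub>b\<rangle> = \<delta>\<^sub>m\<^sub>n k\<^sub>a(b)\<close> (lemma \<open>model_kernel_gram\<close>),
  which holds because multiplication by \<theta> is isometric on \<open>H\<^sup>2\<close> (lemma
  \<open>h1_inner_mult_inner_function\<close>): inner products are limits of means over circles of
  radius \<open>r < 1\<close>, and \<open>\<bar>\<theta>\<bar>\<^sup>2\<close> tends to 1 almost everywhere on these circles.

  In two variables let \<open>k\<^sub>q\<close>, for a point q of the bidisk, be the product of the two model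
  kernels at the coordinates of q, and put \<open>L\<^sub>q g = k\<^sub>q \<cdot> C g\<close>, where C is the composition
  operator. Expanding g in monomials turns the relation above into
  \<open>\<langle>L\<^sub>q g, L\<^sub>q\<^sub>' h\<rangle> = k\<^sub>q(q') \<langle>g, h\<rangle>\<close> (lemma \<open>lift_inner\<close>). Since
  \<open>1 / (1 - cnj a * z) = k\<^sub>a(z) / (1 - cnj (\<theta> a) * \<theta> z)\<close>, the Szego kernel \<open>S\<^sub>\<alpha>\<close> satisfies
  \<open>S\<^sub>\<alpha> \<cdot> C f = L\<^sub>\<alpha> (S\<^sub>\<beta> f)\<close>, where \<beta> is the image of \<alpha> under \<open>(\<theta>, \<phi>)\<close>, and \<open>S\<^sub>\<beta> f\<close>
  stays in M when f is in M.

  The claimed kernel is \<open>F\<^sub>q = L\<^sub>q K\<^sub>p\<close>, where p is the image of q under \<open>(\<theta>, \<phi>)\<close>. It lies in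
  the generated submodule because \<open>F\<^sub>q = S\<^sub>q \<cdot> C f\<close> for a suitable f in M (lemma
  \<open>lift_in_generated_submodule\<close>). It reproduces all functions \<open>S\<^sub>\<alpha> \<cdot> C f\<close> with f in M by the
  inner product formula. Both sides of this identity are power series in the conjugate of
  \<alpha>, so comparing coefficients shows that \<open>F\<^sub>q\<close> reproduces \<open>z\<^sup>m w\<^sup>n \<cdot> C f\<close> (lemma
  \<open>inner_monomial_lifted_kernel\<close>), and then, by linearity and continuity, the whole generated
  submodule. A reproducing kernel is unique.
\<close>

section \<open>The Hardy space of the bidisk as a space of coefficient sequences\<close>

lemma higher_deriv_of_power_series:
  fixes c :: "nat \<Rightarrow> complex"
  assumes "\<And>w. w \<in> disk \<Longrightarrow> ((\<lambda>n. c n * w ^ n) has_sum g w) UNIV"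
  shows "(deriv ^^ n) g 0 = fact n * c n"
proof -
  have sums: "(\<lambda>n. c n * w ^ n) sums g w" if "w \<in> disk" for w
    using assms[OF that] by (rule has_sum_imp_sums)
  have "g has_fps_expansion Abs_fps c"
  proof (rule has_fps_expansionI)
    have "eventually (\<lambda>u. u \<in> disk) (nhds 0)"
      by (rule eventually_nhds_in_open) auto
    thus "eventually (\<lambda>u. (\<lambda>n. fps_nth (Abs_fps c) n * u ^ n) sums g u) (nhds 0)"
      by eventually_elim (use sums in simp)
  qed
  thus ?thesis
    using fps_nth_fps_expansion[of g "Abs_fps c" n] by (simp add: field_simps)
qed

lemma has_sum_Times_iterated:
  fixes f :: "'a \<times> 'b \<Rightarrow> complex"
  assumes "(f has_sum S) (A \<times> B)"
  shows "((\<lambda>x. \<Sum>\<^sub>\<infinity>y\<in>B. f (x, y)) has_sum S) A"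
proof (rule has_sum_SigmaD[OF assms])
  fix x assume "x \<in> A"
  have "(\<lambda>(x, y). f (x, y)) summable_on Sigma A (\<lambda>_. B)"
    using assms by (simp add: has_sum_imp_summable)
  hence "(\<lambda>y. f (x, y)) summable_on B"
    using \<open>x \<in> A\<close> by (rule summable_on_SigmaD1)
  thus "((\<lambda>y. f (x, y)) has_sum (\<Sum>\<^sub>\<infinity>y\<in>B. f (x, y))) B" by simp
qed

text \<open>A double power series is iterated: for fixed z it is a power series in w whose n-th coefficient
  is itself a power series in z, so each of the two iterated derivatives picks out one index.\<close>

lemma taylor_coeff_unique:
  assumes exp: "\<And>z w. z \<in> disk \<Longrightarrow> w \<in> disk \<Longrightarrow>
      ((\<lambda>(m, n). a m n * z ^ m * w ^ n) has_sum f (z, w)) UNIV"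
  shows "taylor_coeff f m n = a m n"
proof -
  define b where "b n z = (\<Sum>\<^sub>\<infinity>m. a m n * z ^ m)" for n and z :: complex
  \<comment> \<open>The inner derivative is taken in w, so the sum over m has to be the inner one.\<close>
  have swapped: "((\<lambda>(n, m). a m n * z ^ m * w ^ n) has_sum f (z, w)) (UNIV \<times> UNIV)"
    if "z \<in> disk" "w \<in> disk" for z w
    using exp[OF that] has_sum_swap[where f = "\<lambda>(m, n). a m n * z ^ m * w ^ n" and S = "f (z, w)" and A = UNIV and B = UNIV]
    by simp
  have row: "((\<lambda>n. b n z * w ^ n) has_sum f (z, w)) UNIV" if "z \<in> disk" "w \<in> disk" for z w
    using has_sum_Times_iterated[OF swapped[OF that]]
    by (simp add: b_def infsum_cmult_left')
  have col: "((\<lambda>m. a m n * z ^ m) has_sum b n z) UNIV" if "z \<in> disk" for n z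
  proof -
    \<comment> \<open>Any nonzero value of w isolates the coefficient of a power of w.\<close>
    have "(\<lambda>(n, m). a m n * z ^ m * (1/2) ^ n) summable_on UNIV \<times> UNIV"
      using swapped[of z "1/2"] that by (auto intro: has_sum_imp_summable)
    hence "(\<lambda>m. a m n * z ^ m * (1/2) ^ n) summable_on UNIV"
      by (rule summable_on_SigmaD1) simp
    hence "(\<lambda>m. a m n * z ^ m) summable_on UNIV"
      by (subst (asm) summable_on_cmult_left') auto
    thus ?thesis by (simp add: b_def)
  qed
  have "(deriv ^^ n) (\<lambda>w. f (z, w)) 0 = fact n * b n z" if "z \<in> disk" for z
    by (rule higher_deriv_of_power_series) (rule row[OF that])
  moreover have "eventually (\<lambda>z. z \<in> disk) (nhds (0::complex))"
    by (rule eventually_nhds_in_open) auto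
  ultimately have "eventually (\<lambda>z. (deriv ^^ n) (\<lambda>w. f (z, w)) 0 = fact n * b n z) (nhds 0)"
    by (auto elim: eventually_mono)
  hence "(deriv ^^ m) (\<lambda>z. (deriv ^^ n) (\<lambda>w. f (z, w)) 0) 0 = (deriv ^^ m) (\<lambda>z. fact n * b n z) 0"
    by (rule higher_deriv_cong_ev) simp
  also have "\<dots> = fact m * (fact n * a m n)"
    by (rule higher_deriv_of_power_series)
       (use has_sum_cmult_right[OF col] in \<open>simp add: mult.assoc\<close>)
  finally show ?thesis by (simp add: taylor_coeff_def)
qed

text \<open>Indexing by pairs makes the inner product and all expansions unconditional sums over a single
  index set.\<close>

definition coeffs2 :: "(complex \<times> complex \<Rightarrow> complex) \<Rightarrow> nat \<times> nat \<Rightarrow> complex" where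
  "coeffs2 f = (\<lambda>(m, n). taylor_coeff f m n)"

definition monom2 :: "complex \<times> complex \<Rightarrow> nat \<times> nat \<Rightarrow> complex" where
  "monom2 p k = fst p ^ fst k * snd p ^ snd k"

text \<open>A square summable family of coefficients determines both membership in the Hardy space and the
  Taylor coefficients occurring in the inner product, so the norm can be computed from any
  expansion.\<close>

lemma hardy2I:
  assumes "(\<lambda>k. (cmod (a k))\<^sup>2) summable_on UNIV"
    and "\<And>p. p \<in> bidisk \<Longrightarrow> ((\<lambda>k. a k * monom2 p k) has_sum f p) UNIV"
    and "\<And>p. p \<notin> bidisk \<Longrightarrow> f p = 0"
  shows "f \<in> hardy2" and "coeffs2 f = a"
proof -
  have eq: "(\<lambda>(m, n). a (m, n) * z ^ m * w ^ n) = (\<lambda>k. a k * monom2 (z, w) k)" for z w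
    by (auto simp: monom2_def fun_eq_iff)
  have exp: "((\<lambda>(m, n). a (m, n) * z ^ m * w ^ n) has_sum f (z, w)) UNIV"
    if "z \<in> disk" "w \<in> disk" for z w
    unfolding eq using assms(2)[of "(z, w)"] that by simp
  show "f \<in> hardy2"
    unfolding hardy2_def using exp assms(1,3)
    by (auto intro!: exI[of _ "\<lambda>m n. a (m, n)"] simp: case_prod_unfold)
  show "coeffs2 f = a"
    using taylor_coeff_unique[of "\<lambda>m n. a (m, n)" f] exp
    by (auto simp: coeffs2_def fun_eq_iff)
qed

lemma hardy2D:
  assumes "f \<in> hardy2"
  shows coeffs2_square_summable: "(\<lambda>k. (cmod (coeffs2 f k))\<^sup>2) summable_on UNIV"
    and coeffs2_has_sum: "p \<in> bidisk \<Longrightarrow> ((\<lambda>k. coeffs2 f k * monom2 p k) has_sum f p) UNIV"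
    and hardy2_outside: "p \<notin> bidisk \<Longrightarrow> f p = 0"
proof -
  obtain a where a: "(\<lambda>(m, n). (cmod (a m n))\<^sup>2) summable_on (UNIV :: (nat \<times> nat) set)"
      "\<And>z w. z \<in> disk \<Longrightarrow> w \<in> disk \<Longrightarrow>
          ((\<lambda>(m, n). a m n * z ^ m * w ^ n) has_sum f (z, w)) UNIV"
      "\<And>p. p \<notin> bidisk \<Longrightarrow> f p = 0"
    using assms by (auto simp: hardy2_def)
  have eq: "(\<lambda>(m, n). a m n * z ^ m * w ^ n) = (\<lambda>k. (case k of (m, n) \<Rightarrow> a m n) * monom2 (z, w) k)"
    for z w
    by (auto simp: monom2_def fun_eq_iff)
  have "coeffs2 f = (\<lambda>(m, n). a m n)"
  proof (rule hardy2I)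
    show "(\<lambda>k. (cmod (case k of (m, n) \<Rightarrow> a m n))\<^sup>2) summable_on UNIV"
      using a(1) by (simp add: case_prod_unfold)
    show "((\<lambda>k. (case k of (m, n) \<Rightarrow> a m n) * monom2 p k) has_sum f p) UNIV" if "p \<in> bidisk" for p
      using a(2)[of "fst p" "snd p"] that unfolding eq by (auto simp: mem_Times_iff)
  qed (rule a(3))
  with a show "(\<lambda>k. (cmod (coeffs2 f k))\<^sup>2) summable_on UNIV"
    and "p \<in> bidisk \<Longrightarrow> ((\<lambda>k. coeffs2 f k * monom2 p k) has_sum f p) UNIV"
    and "p \<notin> bidisk \<Longrightarrow> f p = 0"
    unfolding eq by (auto simp: case_prod_unfold)
qed

lemma square_summable_mult:
  fixes a b :: "'a \<Rightarrow> complex"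
  assumes "(\<lambda>k. (cmod (a k))\<^sup>2) summable_on A" "(\<lambda>k. (cmod (b k))\<^sup>2) summable_on A"
  shows "(\<lambda>k. a k * cnj (b k)) summable_on A"
proof -
  have "(\<lambda>k. norm (a k * cnj (b k))) summable_on A"
    by (rule abs_summable_product)
       (use assms in \<open>simp_all add: norm_mult power2_eq_square\<close>)
  thus ?thesis by (rule abs_summable_summable)
qed

lemma square_summable_add:
  fixes a b :: "'a \<Rightarrow> complex"
  assumes "(\<lambda>k. (cmod (a k))\<^sup>2) summable_on A" "(\<lambda>k. (cmod (b k))\<^sup>2) summable_on A"
  shows "(\<lambda>k. (cmod (a k + b k))\<^sup>2) summable_on A"
proof (rule summable_on_comparison_test)
  show "(\<lambda>k. 2 * (cmod (a k))\<^sup>2 + 2 * (cmod (b k))\<^sup>2) summable_on A"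
    by (intro summable_on_add summable_on_cmult_right assms)
  fix k
  have "(cmod (a k + b k))\<^sup>2 \<le> (cmod (a k) + cmod (b k))\<^sup>2"
    by (intro power_mono norm_triangle_ineq) simp
  also have "\<dots> \<le> 2 * (cmod (a k))\<^sup>2 + 2 * (cmod (b k))\<^sup>2"
    using sum_squares_bound[of "cmod (a k)" "cmod (b k)"] by (simp add: power2_sum)
  finally show "(cmod (a k + b k))\<^sup>2 \<le> 2 * (cmod (a k))\<^sup>2 + 2 * (cmod (b k))\<^sup>2" .
qed simp

lemma
  assumes "f \<in> hardy2" "g \<in> hardy2"
  shows hardy2_add: "(\<lambda>p. f p + g p) \<in> hardy2"
    and coeffs2_add: "coeffs2 (\<lambda>p. f p + g p) = (\<lambda>k. coeffs2 f k + coeffs2 g k)"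
proof -
  note * = hardy2I[of "\<lambda>k. coeffs2 f k + coeffs2 g k" "\<lambda>p. f p + g p"]
  have 1: "(\<lambda>k. (cmod (coeffs2 f k + coeffs2 g k))\<^sup>2) summable_on UNIV"
    by (intro square_summable_add coeffs2_square_summable assms)
  have 2: "((\<lambda>k. (coeffs2 f k + coeffs2 g k) * monom2 p k) has_sum f p + g p) UNIV"
    if "p \<in> bidisk" for p
    using has_sum_add[OF coeffs2_has_sum[OF assms(1) that] coeffs2_has_sum[OF assms(2) that]]
    by (simp add: ring_distribs)
  show "(\<lambda>p. f p + g p) \<in> hardy2" "coeffs2 (\<lambda>p. f p + g p) = (\<lambda>k. coeffs2 f k + coeffs2 g k)"
    using *[OF 1 2] hardy2_outside[OF assms(1)] hardy2_outside[OF assms(2)] by auto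
qed

lemma
  assumes "f \<in> hardy2"
  shows hardy2_cmult: "(\<lambda>p. c * f p) \<in> hardy2"
    and coeffs2_cmult: "coeffs2 (\<lambda>p. c * f p) = (\<lambda>k. c * coeffs2 f k)"
proof -
  note * = hardy2I[of "\<lambda>k. c * coeffs2 f k" "\<lambda>p. c * f p"]
  have 1: "(\<lambda>k. (cmod (c * coeffs2 f k))\<^sup>2) summable_on UNIV"
    unfolding norm_mult power_mult_distrib
    by (intro summable_on_cmult_right coeffs2_square_summable assms)
  have 2: "((\<lambda>k. (c * coeffs2 f k) * monom2 p k) has_sum c * f p) UNIV"
    if "p \<in> bidisk" for p
    using has_sum_cmult_right[OF coeffs2_has_sum[OF assms(1) that]]
    by (simp add: mult.assoc)
  show "(\<lambda>p. c * f p) \<in> hardy2" "coeffs2 (\<lambda>p. c * f p) = (\<lambda>k. c * coeffs2 f k)"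
    using *[OF 1 2] hardy2_outside[OF assms(1)] by auto
qed

lemma hardy2_zero: "(\<lambda>p. 0) \<in> hardy2"
  and coeffs2_zero: "coeffs2 (\<lambda>p. 0) = (\<lambda>k. 0)"
  using hardy2I[of "\<lambda>_. 0" "\<lambda>_. 0"] by auto

lemma hardy2_diff: "f \<in> hardy2 \<Longrightarrow> g \<in> hardy2 \<Longrightarrow> (\<lambda>p. f p - g p) \<in> hardy2"
  using hardy2_add[OF _ hardy2_cmult[of g "-1"], of f] by simp

lemma coeffs2_diff:
  "f \<in> hardy2 \<Longrightarrow> g \<in> hardy2 \<Longrightarrow> coeffs2 (\<lambda>p. f p - g p) = (\<lambda>k. coeffs2 f k - coeffs2 g k)"
  using coeffs2_add[OF _ hardy2_cmult[of g "-1"], of f] coeffs2_cmult[of g "-1"] by simp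

lemma
  assumes "\<And>i. i \<in> S \<Longrightarrow> v i \<in> hardy2"
  shows hardy2_sum: "(\<lambda>p. \<Sum>i\<in>S. v i p) \<in> hardy2"
    and coeffs2_sum: "coeffs2 (\<lambda>p. \<Sum>i\<in>S. v i p) = (\<lambda>k. \<Sum>i\<in>S. coeffs2 (v i) k)"
proof -
  have "(\<lambda>p. \<Sum>i\<in>S. v i p) \<in> hardy2 \<and>
    coeffs2 (\<lambda>p. \<Sum>i\<in>S. v i p) = (\<lambda>k. \<Sum>i\<in>S. coeffs2 (v i) k)"
    using assms
    by (induction S rule: infinite_finite_induct)
       (auto simp: hardy2_zero coeffs2_zero hardy2_add coeffs2_add)
  thus "(\<lambda>p. \<Sum>i\<in>S. v i p) \<in> hardy2"
    "coeffs2 (\<lambda>p. \<Sum>i\<in>S. v i p) = (\<lambda>k. \<Sum>i\<in>S. coeffs2 (v i) k)" by auto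
qed

lemma h2_inner_has_sum:
  assumes "f \<in> hardy2" "g \<in> hardy2"
  shows "((\<lambda>k. coeffs2 f k * cnj (coeffs2 g k)) has_sum h2_inner f g) UNIV"
  using square_summable_mult[OF coeffs2_square_summable[OF assms(1)] coeffs2_square_summable[OF assms(2)]]
  by (simp add: h2_inner_def coeffs2_def case_prod_unfold)

lemma h2_inner_eqI:
  "f \<in> hardy2 \<Longrightarrow> g \<in> hardy2 \<Longrightarrow>
    ((\<lambda>k. coeffs2 f k * cnj (coeffs2 g k)) has_sum s) UNIV \<Longrightarrow> h2_inner f g = s"
  using h2_inner_has_sum has_sum_unique by blast

lemma h2_inner_commute: "h2_inner f g = cnj (h2_inner g f)"
  by (simp add: h2_inner_def case_prod_unfold mult.commute flip: infsum_cnj)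

lemma h2_inner_add_left:
  assumes "f \<in> hardy2" "g \<in> hardy2" "h \<in> hardy2"
  shows "h2_inner (\<lambda>p. f p + g p) h = h2_inner f h + h2_inner g h"
  by (rule h2_inner_eqI)
     (use assms has_sum_add[OF h2_inner_has_sum[OF assms(1,3)] h2_inner_has_sum[OF assms(2,3)]]
      in \<open>simp_all add: hardy2_add coeffs2_add ring_distribs\<close>)

lemma h2_inner_cmult_left:
  assumes "f \<in> hardy2" "h \<in> hardy2"
  shows "h2_inner (\<lambda>p. c * f p) h = c * h2_inner f h"
  by (rule h2_inner_eqI)
     (use assms has_sum_cmult_right[OF h2_inner_has_sum[OF assms]]
      in \<open>simp_all add: hardy2_cmult coeffs2_cmult mult.assoc\<close>)

lemma h2_inner_add_right:
  assumes "f \<in> hardy2" "g \<in> hardy2" "h \<in> hardy2"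
  shows "h2_inner h (\<lambda>p. f p + g p) = h2_inner h f + h2_inner h g"
  unfolding h2_inner_commute[of h "\<lambda>p. f p + g p"] h2_inner_add_left[OF assms]
  using h2_inner_commute[of h f] h2_inner_commute[of h g] by (metis complex_cnj_add)

lemma h2_inner_cmult_right:
  assumes "f \<in> hardy2" "h \<in> hardy2"
  shows "h2_inner h (\<lambda>p. c * f p) = cnj c * h2_inner h f"
  unfolding h2_inner_commute[of h "\<lambda>p. c * f p"] h2_inner_cmult_left[OF assms]
  using h2_inner_commute[of h f] by (metis complex_cnj_mult)

lemma h2_inner_zero_left: "h2_inner (\<lambda>p. 0) h = 0"
  using coeffs2_zero by (simp add: h2_inner_def coeffs2_def fun_eq_iff case_prod_unfold)

lemma h2_inner_diff_left:
  assumes "f \<in> hardy2" "g \<in> hardy2" "h \<in> hardy2"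
  shows "h2_inner (\<lambda>p. f p - g p) h = h2_inner f h - h2_inner g h"
  using h2_inner_add_left[OF assms(1) hardy2_cmult[OF assms(2), of "-1"] assms(3)]
        h2_inner_cmult_left[OF assms(2,3), of "-1"] by simp

lemma h2_inner_sum_left:
  assumes "\<And>i. i \<in> S \<Longrightarrow> v i \<in> hardy2" "h \<in> hardy2"
  shows "h2_inner (\<lambda>p. \<Sum>i\<in>S. v i p) h = (\<Sum>i\<in>S. h2_inner (v i) h)"
  using assms
  by (induction S rule: infinite_finite_induct)
     (auto simp: h2_inner_zero_left h2_inner_add_left hardy2_sum)

lemma h2_inner_self_has_sum:
  assumes "f \<in> hardy2"
  shows "((\<lambda>k. (cmod (coeffs2 f k))\<^sup>2) has_sum Re (h2_inner f f)) UNIV"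
  using has_sum_Re[OF h2_inner_has_sum[OF assms assms]]
  by (simp only: complex_norm_square[symmetric] Re_complex_of_real)

lemma h2_inner_self_nonneg: "f \<in> hardy2 \<Longrightarrow> 0 \<le> Re (h2_inner f f)"
  by (rule has_sum_nonneg[OF h2_inner_self_has_sum]) auto

lemma h2_norm_nonneg: "f \<in> hardy2 \<Longrightarrow> 0 \<le> h2_norm f"
  by (simp add: h2_norm_def h2_inner_self_nonneg)

lemma h2_norm_sq: "f \<in> hardy2 \<Longrightarrow> (h2_norm f)\<^sup>2 = Re (h2_inner f f)"
  by (simp add: h2_norm_def h2_inner_self_nonneg)

lemma h2_inner_self:
  assumes "f \<in> hardy2" shows "h2_inner f f = of_real ((h2_norm f)\<^sup>2)"
proof -
  have "Im (h2_inner f f) = Im (cnj (h2_inner f f))"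
    by (rule arg_cong[OF h2_inner_commute])
  thus ?thesis using assms by (simp add: h2_norm_sq complex_eq_iff)
qed

lemma h2_norm_sq_has_sum:
  "f \<in> hardy2 \<Longrightarrow> ((\<lambda>k. (cmod (coeffs2 f k))\<^sup>2) has_sum (h2_norm f)\<^sup>2) UNIV"
  by (simp add: h2_norm_sq h2_inner_self_has_sum)

text \<open>The inequality for finite partial sums passes to the limit.\<close>

lemma h2_cauchy_schwarz:
  assumes f: "f \<in> hardy2" and g: "g \<in> hardy2"
  shows "cmod (h2_inner f g) \<le> h2_norm f * h2_norm g"
proof -
  have bound: "norm (\<Sum>k\<in>S. coeffs2 f k * cnj (coeffs2 g k)) \<le> h2_norm f * h2_norm g"
    if "finite S" for S
  proof -
    have L2: "L2_set (\<lambda>k. cmod (coeffs2 h k)) S \<le> h2_norm h" if "h \<in> hardy2" for h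
      unfolding L2_set_def
      by (rule real_le_lsqrt[OF h2_norm_nonneg[OF that]])
         (rule finite_sum_le_has_sum[OF h2_norm_sq_has_sum[OF that] \<open>finite S\<close>], auto)
    have "norm (\<Sum>k\<in>S. coeffs2 f k * cnj (coeffs2 g k)) \<le> (\<Sum>k\<in>S. cmod (coeffs2 f k) * cmod (coeffs2 g k))"
      by (rule order_trans[OF norm_sum]) (simp add: norm_mult)
    also have "\<dots> \<le> L2_set (\<lambda>k. cmod (coeffs2 f k)) S * L2_set (\<lambda>k. cmod (coeffs2 g k)) S"
      using L2_set_mult_ineq[of "\<lambda>k. cmod (coeffs2 f k)" "\<lambda>k. cmod (coeffs2 g k)" S] by simp
    also have "\<dots> \<le> h2_norm f * h2_norm g"
      by (intro mult_mono L2 f g) (simp_all add: h2_norm_nonneg f L2_set_nonneg)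
    finally show ?thesis .
  qed
  have lim: "((\<lambda>S. \<Sum>k\<in>S. coeffs2 f k * cnj (coeffs2 g k)) \<longlongrightarrow> h2_inner f g)
      (finite_subsets_at_top UNIV)"
    using h2_inner_has_sum[OF f g] by (simp add: has_sum_def)
  show ?thesis
    by (rule tendsto_upperbound[OF tendsto_norm[OF lim]])
       (auto intro!: eventually_finite_subsets_at_top_weakI bound)
qed

lemma h2_norm_triangle:
  assumes f: "f \<in> hardy2" and g: "g \<in> hardy2"
  shows "h2_norm (\<lambda>p. f p + g p) \<le> h2_norm f + h2_norm g"
proof (rule power2_le_imp_le)
  have "(h2_norm (\<lambda>p. f p + g p))\<^sup>2 = Re (h2_inner f f + h2_inner f g + (h2_inner g f + h2_inner g g))"
    using f g by (simp add: h2_norm_sq h2_inner_add_left h2_inner_add_right hardy2_add)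
  also have "\<dots> = (h2_norm f)\<^sup>2 + 2 * Re (h2_inner f g) + (h2_norm g)\<^sup>2"
    by (subst h2_inner_commute[of g f]) (simp add: h2_norm_sq f g)
  also have "\<dots> \<le> (h2_norm f)\<^sup>2 + 2 * (h2_norm f * h2_norm g) + (h2_norm g)\<^sup>2"
    using complex_Re_le_cmod[of "h2_inner f g"] h2_cauchy_schwarz[OF f g] by linarith
  finally show "(h2_norm (\<lambda>p. f p + g p))\<^sup>2 \<le> (h2_norm f + h2_norm g)\<^sup>2"
    by (simp add: power2_sum)
qed (use f g in \<open>simp add: h2_norm_nonneg\<close>)

lemma h2_norm_cmult:
  assumes f: "f \<in> hardy2"
  shows "h2_norm (\<lambda>p. c * f p) = cmod c * h2_norm f"
proof -
  have "h2_inner (\<lambda>p. c * f p) (\<lambda>p. c * f p) = c * cnj c * h2_inner f f"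
    using f by (simp add: h2_inner_cmult_left h2_inner_cmult_right hardy2_cmult)
  also have "\<dots> = of_real ((cmod c * h2_norm f)\<^sup>2)"
    unfolding complex_norm_square[symmetric] h2_inner_self[OF f] power_mult_distrib by simp
  finally have "Re (h2_inner (\<lambda>p. c * f p) (\<lambda>p. c * f p)) = (cmod c * h2_norm f)\<^sup>2"
    by (simp only: Re_complex_of_real)
  thus ?thesis
    unfolding h2_norm_def[of "\<lambda>p. c * f p"] using h2_norm_nonneg[OF f] by simp
qed

lemma h2_norm_zero: "h2_norm (\<lambda>p. 0) = 0"
  by (simp add: h2_norm_def h2_inner_zero_left)

lemma h2_norm_sum_le:
  assumes "\<And>i. i \<in> S \<Longrightarrow> v i \<in> hardy2"
  shows "h2_norm (\<lambda>p. \<Sum>i\<in>S. v i p) \<le> (\<Sum>i\<in>S. h2_norm (v i))"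
  using assms
proof (induction S rule: infinite_finite_induct)
  case (insert x S)
  have "h2_norm (\<lambda>p. v x p + (\<Sum>i\<in>S. v i p)) \<le> h2_norm (v x) + h2_norm (\<lambda>p. \<Sum>i\<in>S. v i p)"
    by (rule h2_norm_triangle) (use insert.prems in \<open>auto intro: hardy2_sum\<close>)
  with insert show ?case by simp
qed (simp_all add: h2_norm_zero)

section \<open>Bounded analytic functions and means over circles\<close>

definition bdd_holo :: "(complex \<Rightarrow> complex) \<Rightarrow> bool" where
  "bdd_holo u \<longleftrightarrow> u holomorphic_on disk \<and> bounded (u ` disk)"

definition coeffs1 :: "(complex \<Rightarrow> complex) \<Rightarrow> nat \<Rightarrow> complex" where
  "coeffs1 u n = (deriv ^^ n) u 0 / fact n"

definition h1_inner :: "(complex \<Rightarrow> complex) \<Rightarrow> (complex \<Rightarrow> complex) \<Rightarrow> complex" where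
  "h1_inner u v = (\<Sum>\<^sub>\<infinity>n. coeffs1 u n * cnj (coeffs1 v n))"

lemma bdd_holo_holomorphic: "bdd_holo u \<Longrightarrow> u holomorphic_on disk"
  by (simp add: bdd_holo_def)

lemma bdd_holo_bound:
  assumes "bdd_holo u"
  shows "\<exists>B>0. \<forall>z\<in>disk. cmod (u z) \<le> B"
  using assms unfolding bdd_holo_def bounded_pos by auto

lemma bdd_holoI:
  "u holomorphic_on disk \<Longrightarrow> (\<And>z. z \<in> disk \<Longrightarrow> cmod (u z) \<le> B) \<Longrightarrow> bdd_holo u"
  by (auto simp: bdd_holo_def intro!: boundedI[where B = B])

lemma bdd_holo_const: "bdd_holo (\<lambda>_. c)"
  by (rule bdd_holoI[of _ "cmod c"]) auto

lemma bdd_holo_mult: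
  assumes "bdd_holo u" "bdd_holo v"
  shows "bdd_holo (\<lambda>z. u z * v z)"
proof -
  obtain A where "A > 0" "\<forall>z\<in>disk. cmod (u z) \<le> A" using bdd_holo_bound[OF assms(1)] by blast
  hence A: "A > 0" "\<And>z. z \<in> disk \<Longrightarrow> cmod (u z) \<le> A" by auto
  obtain B where "B > 0" "\<forall>z\<in>disk. cmod (v z) \<le> B" using bdd_holo_bound[OF assms(2)] by blast
  hence B: "B > 0" "\<And>z. z \<in> disk \<Longrightarrow> cmod (v z) \<le> B" by auto
  show ?thesis
  proof (rule bdd_holoI)
    show "(\<lambda>z. u z * v z) holomorphic_on disk"
      by (intro holomorphic_on_mult assms[THEN bdd_holo_holomorphic])
    show "cmod (u z * v z) \<le> A * B" if "z \<in> disk" for z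
      unfolding norm_mult by (rule mult_mono) (use A B that in auto)
  qed
qed

lemma bdd_holo_diff:
  assumes "bdd_holo u" "bdd_holo v"
  shows "bdd_holo (\<lambda>z. u z - v z)"
proof -
  obtain A where "A > 0" "\<forall>z\<in>disk. cmod (u z) \<le> A" using bdd_holo_bound[OF assms(1)] by blast
  hence A: "A > 0" "\<And>z. z \<in> disk \<Longrightarrow> cmod (u z) \<le> A" by auto
  obtain B where "B > 0" "\<forall>z\<in>disk. cmod (v z) \<le> B" using bdd_holo_bound[OF assms(2)] by blast
  hence B: "B > 0" "\<And>z. z \<in> disk \<Longrightarrow> cmod (v z) \<le> B" by auto
  show ?thesis
  proof (rule bdd_holoI)
    show "(\<lambda>z. u z - v z) holomorphic_on disk"
      by (intro holomorphic_on_diff assms[THEN bdd_holo_holomorphic])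
    show "cmod (u z - v z) \<le> A + B" if "z \<in> disk" for z
      using norm_triangle_ineq4[of "u z" "v z"] A(2)[OF that] B(2)[OF that] by linarith
  qed
qed

lemma bdd_holo_power: "bdd_holo u \<Longrightarrow> bdd_holo (\<lambda>z. u z ^ n)"
  by (induction n) (auto simp: bdd_holo_const bdd_holo_mult)

lemma coeffs1_eqI:
  "(\<And>z. z \<in> disk \<Longrightarrow> ((\<lambda>n. c n * z ^ n) has_sum u z) UNIV) \<Longrightarrow> coeffs1 u = c"
  using higher_deriv_of_power_series[of c u] by (auto simp: coeffs1_def fun_eq_iff)

lemma coeffs1_abs_summable:
  assumes "bdd_holo u" "0 \<le> r" "r < 1"
  shows "summable (\<lambda>n. cmod (coeffs1 u n) * r ^ n)"
proof -
  \<comment> \<open>Absolute convergence at r follows from convergence at any larger radius inside the disk.\<close>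
  define s where "s = (1 + r) / 2"
  have s: "r < s" "s < 1" using assms by (auto simp: s_def)
  have "(\<lambda>n. coeffs1 u n * of_real s ^ n) sums u (of_real s)"
    using holomorphic_power_series[of u 0 1 "of_real s"] assms s
    by (simp add: coeffs1_def bdd_holo_holomorphic)
  hence "summable (\<lambda>n. coeffs1 u n * of_real s ^ n)" by (rule sums_summable)
  hence "summable (\<lambda>n. norm (coeffs1 u n * of_real r ^ n))"
    by (rule powser_insidea) (use assms s in simp)
  thus ?thesis using assms by (simp add: norm_mult norm_power)
qed

lemma coeffs1_has_sum:
  assumes "bdd_holo u" "z \<in> disk"
  shows "((\<lambda>n. coeffs1 u n * z ^ n) has_sum u z) UNIV"
proof (rule norm_summable_imp_has_sum)
  show "summable (\<lambda>n. norm (coeffs1 u n * z ^ n))"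
    using coeffs1_abs_summable[OF assms(1), of "norm z"] assms(2)
    by (simp add: norm_mult norm_power)
  show "(\<lambda>n. coeffs1 u n * z ^ n) sums u z"
    using holomorphic_power_series[of u 0 1 z] assms
    by (simp add: coeffs1_def bdd_holo_holomorphic)
qed

lemma coeffs1_diff_cmult:
  assumes "bdd_holo u" "bdd_holo v"
  shows "coeffs1 (\<lambda>z. u z - c * v z) = (\<lambda>n. coeffs1 u n - c * coeffs1 v n)"
proof (rule coeffs1_eqI)
  fix z assume z: "z \<in> disk"
  have "((\<lambda>n. coeffs1 u n * z ^ n + - c * (coeffs1 v n * z ^ n)) has_sum u z + - c * v z) UNIV"
    by (intro has_sum_add has_sum_cmult_right coeffs1_has_sum assms z)
  thus "((\<lambda>n. (coeffs1 u n - c * coeffs1 v n) * z ^ n) has_sum u z - c * v z) UNIV"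
    by (simp add: algebra_simps)
qed

definition circ :: "real measure" where
  "circ = restrict_space lborel {0..2 * pi}"

lemma finite_measure_circ: "finite_measure circ"
  by (rule finite_measureI) (simp add: circ_def space_restrict_space emeasure_restrict_space)

lemma measure_circ: "measure circ (space circ) = 2 * pi"
  by (simp add: circ_def space_restrict_space measure_restrict_space)

lemma borel_measurable_circ:
  fixes g :: "real \<Rightarrow> 'a :: {second_countable_topology, real_normed_vector}"
  shows "continuous_on UNIV g \<Longrightarrow> g \<in> borel_measurable circ"
  unfolding circ_def by (intro measurable_restrict_space1) (simp add: borel_measurable_continuous_onI)

lemma integrable_circ:
  fixes g :: "real \<Rightarrow> complex"
  assumes "continuous_on UNIV g" "\<And>t. cmod (g t) \<le> B"
  shows "integrable circ g"
  by (rule finite_measure.integrable_const_bound[OF finite_measure_circ, where B = B])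
     (use assms in \<open>auto intro: borel_measurable_circ\<close>)

text \<open>Orthogonality of the characters of the circle, by evaluating an antiderivative at both ends
  of a full period.\<close>

lemma integral_circ_cis:
  "(\<integral>t. cis (of_int k * t) \<partial>circ) = (if k = 0 then of_real (2 * pi) else 0)"
proof (cases "k = 0")
  case True
  thus ?thesis by (simp add: measure_circ scaleR_conv_of_real)
next
  case False
  define F where "F t = cis (of_int k * t) / (\<i> * of_int k)" for t :: real
  have "(\<integral>t. cis (of_int k * t) \<partial>circ) = (\<integral>t. indicator {0..2*pi} t *\<^sub>R cis (of_int k * t) \<partial>lborel)"
    unfolding circ_def by (subst integral_restrict_space) auto
  also have "\<dots> = F (2 * pi) - F 0"
  proof (rule integral_FTC_Icc)
    show "(F has_vector_derivative cis (of_int k * x)) (at x within {0..2*pi})" for x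
      unfolding F_def cis_conv_exp using False
      by (auto intro!: derivative_eq_intros has_vector_derivative_real_field simp: field_simps)
    show "continuous_on {0..2*pi} (\<lambda>x. cis (of_int k * x))"
      by (intro continuous_intros)
  qed simp
  also have "\<dots> = 0"
    using cis_multiple_2pi[of "of_int k"] by (simp add: F_def mult.commute mult.left_commute)
  finally show ?thesis using False by simp
qed

lemma circle_in_disk: "0 \<le> r \<Longrightarrow> r < 1 \<Longrightarrow> of_real r * cis t \<in> disk"
  by (simp add: norm_mult)

lemma continuous_on_circle:
  assumes "bdd_holo u" "0 \<le> r" "r < 1"
  shows "continuous_on UNIV (\<lambda>t. u (of_real r * cis t))"
  by (rule continuous_on_compose2[OF holomorphic_on_imp_continuous_on[OF bdd_holo_holomorphic[OF assms(1)]]])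
     (use assms circle_in_disk in \<open>auto intro!: continuous_intros\<close>)

text \<open>On a circle of radius \<open>r < 1\<close> the Taylor series is dominated by a convergent numerical series,
  so it may be integrated term by term against any bounded continuous weight.\<close>

lemma circle_integral_sums:
  assumes u: "bdd_holo u" and r: "0 \<le> r" "r < 1"
    and g: "continuous_on UNIV g" and B: "\<And>t. cmod (g t) \<le> B"
  shows "(\<lambda>n. coeffs1 u n * of_real (r ^ n) * (\<integral>t. cis (of_nat n * t) * g t \<partial>circ))
           sums (\<integral>t. u (of_real r * cis t) * g t \<partial>circ)"
proof -
  define f where "f n t = coeffs1 u n * of_real (r ^ n) * (cis (of_nat n * t) * g t)" for n t
  have B0: "0 \<le> B" using B[of 0] norm_ge_zero order_trans by blast
  have nf: "norm (f n t) \<le> cmod (coeffs1 u n) * r ^ n * B" for n t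
    unfolding f_def using B[of t] r by (auto simp: norm_mult norm_power intro!: mult_left_mono)
  have cf: "continuous_on UNIV (f n)" for n
    unfolding f_def by (intro continuous_intros g)
  have int: "integrable circ (f n)" for n
    by (rule integrable_circ[OF cf nf])
  have sm: "summable (\<lambda>n. cmod (coeffs1 u n) * r ^ n * B)"
    by (intro summable_mult2 coeffs1_abs_summable u r)
  have s1: "summable (\<lambda>n. norm (f n t))" for t
    by (rule summable_comparison_test'[OF sm]) (use nf in simp)
  have s2: "summable (\<lambda>n. \<integral>t. norm (f n t) \<partial>circ)"
  proof (rule summable_comparison_test')
    show "summable (\<lambda>n. cmod (coeffs1 u n) * r ^ n * B * (2 * pi))"
      by (intro summable_mult2 sm)
    fix n
    have "(\<integral>t. norm (f n t) \<partial>circ) \<le> (\<integral>t. cmod (coeffs1 u n) * r ^ n * B \<partial>circ)"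
      by (intro integral_mono integrable_norm int nf)
         (simp add: finite_measure.integrable_const finite_measure_circ)
    also have "\<dots> = cmod (coeffs1 u n) * r ^ n * B * (2 * pi)"
      by (simp add: measure_circ)
    finally show "norm (\<integral>t. norm (f n t) \<partial>circ) \<le> cmod (coeffs1 u n) * r ^ n * B * (2 * pi)"
      by (simp add: integral_nonneg)
  qed
  have "(\<lambda>n. \<integral>t. f n t \<partial>circ) sums (\<integral>t. (\<Sum>n. f n t) \<partial>circ)"
    by (rule sums_integral[OF int _ s2]) (use s1 in simp)
  moreover have "(\<Sum>n. f n t) = u (of_real r * cis t) * g t" for t
  proof -
    have "(\<lambda>n. coeffs1 u n * (of_real r * cis t) ^ n * g t) sums (u (of_real r * cis t) * g t)"
      by (intro sums_mult2 has_sum_imp_sums coeffs1_has_sum u circle_in_disk r)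
    hence "(\<lambda>n. f n t) sums (u (of_real r * cis t) * g t)"
      by (simp add: f_def power_mult_distrib Complex.DeMoivre mult.assoc)
    thus ?thesis by (simp add: sums_iff)
  qed
  ultimately show ?thesis by (simp add: f_def)
qed

lemma circle_integral_coeff:
  assumes u: "bdd_holo u" and r: "0 \<le> r" "r < 1"
  shows "(\<integral>t. u (of_real r * cis t) * cis (- (of_nat n * t)) \<partial>circ) =
           of_real (2 * pi) * (coeffs1 u n * of_real (r ^ n))"
proof -
  have "(\<lambda>m. coeffs1 u m * of_real (r ^ m) * (\<integral>t. cis (of_nat m * t) * cis (- (of_nat n * t)) \<partial>circ))
          sums (\<integral>t. u (of_real r * cis t) * cis (- (of_nat n * t)) \<partial>circ)"
    by (rule circle_integral_sums[OF u r, where B = 1]) (auto intro!: continuous_intros)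
  moreover have "(\<integral>t. cis (of_nat m * t) * cis (- (of_nat n * t)) \<partial>circ) =
      (if m = n then of_real (2 * pi) else 0)" for m
    using integral_circ_cis[of "int m - int n"] by (simp add: cis_mult algebra_simps)
  ultimately have "(\<lambda>m. if m = n then coeffs1 u m * of_real (r ^ m) * of_real (2 * pi) else 0)
          sums (\<integral>t. u (of_real r * cis t) * cis (- (of_nat n * t)) \<partial>circ)"
    by (simp add: if_distrib cong: if_cong)
  from sums_unique2[OF this sums_single] show ?thesis by (simp add: mult_ac)
qed

text \<open>Termwise integration applied twice: first to the series of u, then to that of v against a
  single character.\<close>

lemma circle_parseval:
  assumes u: "bdd_holo u" and v: "bdd_holo v" and r: "0 \<le> r" "r < 1"
  shows "(\<lambda>n. coeffs1 u n * cnj (coeffs1 v n) * of_real (r ^ (2 * n)))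
           sums ((\<integral>t. u (of_real r * cis t) * cnj (v (of_real r * cis t)) \<partial>circ) / of_real (2 * pi))"
proof -
  obtain B where "B > 0" "\<forall>z\<in>disk. cmod (v z) \<le> B" using bdd_holo_bound[OF v] by blast
  hence B: "B > 0" "\<And>z. z \<in> disk \<Longrightarrow> cmod (v z) \<le> B" by auto
  have "(\<lambda>n. coeffs1 u n * of_real (r ^ n) *
      (\<integral>t. cis (of_nat n * t) * cnj (v (of_real r * cis t)) \<partial>circ))
      sums (\<integral>t. u (of_real r * cis t) * cnj (v (of_real r * cis t)) \<partial>circ)"
    using B(2)[OF circle_in_disk[OF r]] by (intro circle_integral_sums[OF u r, where B = B])
       (auto intro!: continuous_intros continuous_on_circle v r)
  moreover have "(\<integral>t. cis (of_nat n * t) * cnj (v (of_real r * cis t)) \<partial>circ) =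
      of_real (2 * pi) * cnj (coeffs1 v n) * of_real (r ^ n)" for n
  proof -
    have "(\<integral>t. cis (of_nat n * t) * cnj (v (of_real r * cis t)) \<partial>circ) =
        (\<integral>t. cnj (v (of_real r * cis t) * cis (- (of_nat n * t))) \<partial>circ)"
      by (simp add: cis_cnj mult.commute)
    also have "\<dots> = cnj (\<integral>t. v (of_real r * cis t) * cis (- (of_nat n * t)) \<partial>circ)"
      by (rule Bochner_Integration.integral_cnj)
    finally show ?thesis by (simp add: circle_integral_coeff[OF v r])
  qed
  ultimately have "(\<lambda>n. coeffs1 u n * of_real (r ^ n) * (of_real (2 * pi) * cnj (coeffs1 v n) * of_real (r ^ n)))
      sums (\<integral>t. u (of_real r * cis t) * cnj (v (of_real r * cis t)) \<partial>circ)" by simp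
  from sums_divide[OF this, of "of_real (2 * pi)"]
  have "(\<lambda>n. coeffs1 u n * of_real (r ^ n) * (of_real (2 * pi) * cnj (coeffs1 v n) * of_real (r ^ n))
      / of_real (2 * pi)) sums
      ((\<integral>t. u (of_real r * cis t) * cnj (v (of_real r * cis t)) \<partial>circ) / of_real (2 * pi))" .
  moreover have "coeffs1 u n * of_real (r ^ n) * (of_real (2 * pi) * cnj (coeffs1 v n) * of_real (r ^ n))
      / of_real (2 * pi) = coeffs1 u n * cnj (coeffs1 v n) * of_real (r ^ (2 * n))" for n
    using power_add[of r n n] by (simp add: mult_ac flip: mult_2)
  ultimately show ?thesis by (simp only:)
qed

text \<open>Radial limits are sampled along a sequence of radii, so that dominated convergence for sequences
  applies to the circle means.\<close>

definition radii :: "nat \<Rightarrow> real" where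
  "radii k = 1 - inverse (real (Suc k))"

lemma radii: "0 \<le> radii k" "radii k < 1"
  by (auto simp: radii_def field_simps)

lemma radii_tendsto: "radii \<longlonglongrightarrow> 1"
  using LIMSEQ_inverse_real_of_nat_add_minus[of 1] by (simp add: radii_def[abs_def])

lemma radii_at_left: "filterlim radii (at_left 1) sequentially"
  using radii_tendsto radii(2) by (auto simp: filterlim_at less_imp_neq)

text \<open>Parseval bounds \<open>\<Sum>\<bar>a\<^sub>n\<bar>\<^sup>2 r\<^sup>2\<^sup>n\<close> by the squared supremum norm for each \<open>r < 1\<close>; now let r tend to 1
  in each finite partial sum.\<close>

lemma coeffs1_square_summable:
  assumes u: "bdd_holo u"
  shows "(\<lambda>n. (cmod (coeffs1 u n))\<^sup>2) summable_on UNIV"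
proof -
  obtain B where "B > 0" "\<forall>z\<in>disk. cmod (u z) \<le> B" using bdd_holo_bound[OF u] by blast
  hence B: "B > 0" "\<And>z. z \<in> disk \<Longrightarrow> cmod (u z) \<le> B" by auto
  have bound: "(\<Sum>n<N. (cmod (coeffs1 u n))\<^sup>2 * r ^ (2 * n)) \<le> B\<^sup>2" if r: "0 \<le> r" "r < 1" for r N
  proof -
    define I where "I = (\<integral>t. u (of_real r * cis t) * cnj (u (of_real r * cis t)) \<partial>circ)"
    have le: "norm (u (of_real r * cis t) * cnj (u (of_real r * cis t))) \<le> B\<^sup>2" for t
      unfolding norm_mult power2_eq_square complex_mod_cnj
      by (intro mult_mono B(2) circle_in_disk r) (use B in auto)
    have int: "integrable circ (\<lambda>t. u (of_real r * cis t) * cnj (u (of_real r * cis t)))"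
      by (rule integrable_circ[OF _ le]) (intro continuous_intros continuous_on_circle u r)
    have "norm I \<le> (\<integral>t. norm (u (of_real r * cis t) * cnj (u (of_real r * cis t))) \<partial>circ)"
      unfolding I_def by (rule integral_norm_bound)
    also have "\<dots> \<le> (\<integral>t. B\<^sup>2 \<partial>circ)"
      by (intro integral_mono integrable_norm int le)
         (simp add: finite_measure.integrable_const finite_measure_circ)
    also have "\<dots> = B\<^sup>2 * (2 * pi)" by (simp add: measure_circ)
    finally have "norm I / (2 * pi) \<le> B\<^sup>2" by (simp add: field_simps)
    hence I: "Re (I / of_real (2 * pi)) \<le> B\<^sup>2"
      using complex_Re_le_cmod[of "I / of_real (2 * pi)"] by (simp add: norm_divide norm_mult)
    have "(\<lambda>n. coeffs1 u n * cnj (coeffs1 u n) * of_real (r ^ (2 * n))) sums (I / of_real (2 * pi))"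
      unfolding I_def by (rule circle_parseval[OF u u r])
    hence "(\<lambda>n. of_real ((cmod (coeffs1 u n))\<^sup>2 * r ^ (2 * n))) sums (I / of_real (2 * pi))"
      by (simp add: complex_norm_square[symmetric])
    hence "(\<lambda>n. (cmod (coeffs1 u n))\<^sup>2 * r ^ (2 * n)) sums Re (I / of_real (2 * pi))"
      by (simp only: sums_complex_iff Re_complex_of_real)
    hence "(\<Sum>n<N. (cmod (coeffs1 u n))\<^sup>2 * r ^ (2 * n)) \<le> Re (I / of_real (2 * pi))"
      using sum_le_suminf[of "\<lambda>n. (cmod (coeffs1 u n))\<^sup>2 * r ^ (2 * n)" "{..<N}"] r
      by (simp add: sums_iff)
    with I show ?thesis by linarith
  qed
  have "(\<Sum>n<N. (cmod (coeffs1 u n))\<^sup>2) \<le> B\<^sup>2" for N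
  proof (rule tendsto_upperbound)
    have "(\<lambda>k. \<Sum>n<N. (cmod (coeffs1 u n))\<^sup>2 * radii k ^ (2 * n)) \<longlonglongrightarrow>
        (\<Sum>n<N. (cmod (coeffs1 u n))\<^sup>2 * 1 ^ (2 * n))"
      by (intro tendsto_intros radii_tendsto)
    thus "(\<lambda>k. \<Sum>n<N. (cmod (coeffs1 u n))\<^sup>2 * radii k ^ (2 * n)) \<longlonglongrightarrow>
        (\<Sum>n<N. (cmod (coeffs1 u n))\<^sup>2)" by simp
  qed (use bound radii in auto)
  hence "summable (\<lambda>n. (cmod (coeffs1 u n))\<^sup>2)"
    by (intro summableI_nonneg_bounded) auto
  thus ?thesis
    by (simp add: summable_on_UNIV_nonneg_real_iff)
qed

lemma h1_inner_has_sum: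
  "bdd_holo u \<Longrightarrow> bdd_holo v \<Longrightarrow>
    ((\<lambda>n. coeffs1 u n * cnj (coeffs1 v n)) has_sum h1_inner u v) UNIV"
  unfolding h1_inner_def
  by (intro has_sum_infsum square_summable_mult coeffs1_square_summable)

text \<open>This makes inner products accessible to boundary behaviour without knowing that the functions
  themselves have boundary values.\<close>

lemma h1_inner_eq_limit:
  assumes u: "bdd_holo u" and v: "bdd_holo v"
  shows "(\<lambda>k. (\<integral>t. u (of_real (radii k) * cis t) * cnj (v (of_real (radii k) * cis t)) \<partial>circ)
            / of_real (2 * pi)) \<longlonglongrightarrow> h1_inner u v"
proof -
  define a where "a n k = coeffs1 u n * cnj (coeffs1 v n) * of_real (radii k ^ (2 * n))" for n k
  have "(\<lambda>n. coeffs1 u n * cnj (coeffs1 v n)) summable_on UNIV"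
    using h1_inner_has_sum[OF u v] by (rule has_sum_imp_summable)
  hence "(\<lambda>n. norm (coeffs1 u n * cnj (coeffs1 v n))) summable_on UNIV"
    by (simp only: summable_on_iff_abs_summable_on_complex)
  hence sm: "summable (\<lambda>n. norm (coeffs1 u n * cnj (coeffs1 v n)))"
    by (rule summable_on_imp_summable)
  have "((\<lambda>k. \<Sum>n. a n k) \<longlonglongrightarrow> (\<Sum>n. coeffs1 u n * cnj (coeffs1 v n)))"
  proof (rule conjunct2[OF conjunct2[OF tannerys_theorem[OF _ _ sm]]])
    have "(\<lambda>k. a n k) \<longlonglongrightarrow> coeffs1 u n * cnj (coeffs1 v n) * of_real (1 ^ (2 * n))" for n
      unfolding a_def by (intro tendsto_intros radii_tendsto)
    thus "(\<lambda>k. a n k) \<longlonglongrightarrow> coeffs1 u n * cnj (coeffs1 v n)" for n by simp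
    have "norm (a n k) \<le> norm (coeffs1 u n * cnj (coeffs1 v n))" for n k
      unfolding a_def norm_mult[of "_ * _"]
      using radii[of k] by (intro mult_right_le_one_le) (auto simp: norm_power intro!: power_le_one)
    thus "\<forall>\<^sub>F (n, k) in sequentially \<times>\<^sub>F sequentially. norm (a n k) \<le> norm (coeffs1 u n * cnj (coeffs1 v n))"
      by (intro always_eventually) auto
  qed simp
  moreover have "(\<Sum>n. a n k) = (\<integral>t. u (of_real (radii k) * cis t) * cnj (v (of_real (radii k) * cis t)) \<partial>circ)
            / of_real (2 * pi)" for k
    using circle_parseval[OF u v radii] by (simp add: a_def sums_iff)
  moreover have "(\<Sum>n. coeffs1 u n * cnj (coeffs1 v n)) = h1_inner u v"
    using has_sum_imp_sums[OF h1_inner_has_sum[OF u v]] by (simp add: sums_iff)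
  ultimately show ?thesis by simp
qed

lemma inner_function_bdd_holo: "inner_function \<theta> \<Longrightarrow> bdd_holo \<theta>"
  by (simp add: inner_function_def bdd_holo_def)

lemma inner_function_boundary:
  assumes "inner_function \<theta>"
  shows "AE t in circ. (\<lambda>k. cmod (\<theta> (of_real (radii k) * cis t))) \<longlonglongrightarrow> 1"
proof -
  have "AE t in lborel. t \<in> {0..2 * pi} \<longrightarrow>
      (\<exists>b. ((\<lambda>r. \<theta> (of_real r * cis t)) \<longlongrightarrow> b) (at_left 1) \<and> cmod b = 1)"
    using assms by (simp add: inner_function_def)
  hence "AE t in circ. \<exists>b. ((\<lambda>r. \<theta> (of_real r * cis t)) \<longlongrightarrow> b) (at_left 1) \<and> cmod b = 1"
    unfolding circ_def by (subst AE_restrict_space_iff) auto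
  thus ?thesis
  proof eventually_elim
    case (elim t)
    then obtain b where b: "((\<lambda>r. \<theta> (of_real r * cis t)) \<longlongrightarrow> b) (at_left 1)" "cmod b = 1" by blast
    show ?case
      using tendsto_norm[OF filterlim_compose[OF b(1) radii_at_left]] b(2) by simp
  qed
qed

text \<open>Multiplication by an inner function is isometric. The difference of the two circle means is the
  mean of \<open>(\<bar>\<theta>\<bar>\<^sup>2 - 1) u (cnj v)\<close>, which is uniformly bounded and tends to 0 almost
  everywhere, hence vanishes in the limit.\<close>

lemma h1_inner_mult_inner_function:
  assumes \<theta>: "inner_function \<theta>" and u: "bdd_holo u" and v: "bdd_holo v"
  shows "h1_inner (\<lambda>z. \<theta> z * u z) (\<lambda>z. \<theta> z * v z) = h1_inner u v"
proof -
  note th = inner_function_bdd_holo[OF \<theta>]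
  obtain C where "C > 0" "\<forall>z\<in>disk. cmod (\<theta> z) \<le> C" using bdd_holo_bound[OF th] by blast
  hence C: "C > 0" "\<And>z. z \<in> disk \<Longrightarrow> cmod (\<theta> z) \<le> C" by auto
  obtain A where "A > 0" "\<forall>z\<in>disk. cmod (u z) \<le> A" using bdd_holo_bound[OF u] by blast
  hence A: "A > 0" "\<And>z. z \<in> disk \<Longrightarrow> cmod (u z) \<le> A" by auto
  obtain B where "B > 0" "\<forall>z\<in>disk. cmod (v z) \<le> B" using bdd_holo_bound[OF v] by blast
  hence B: "B > 0" "\<And>z. z \<in> disk \<Longrightarrow> cmod (v z) \<le> B" by auto
  define p where "p k t = of_real (radii k) * cis t" for k and t :: real
  have p: "p k t \<in> disk" for k t unfolding p_def by (intro circle_in_disk radii)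
  define D where "D k t = ((cmod (\<theta> (p k t)))\<^sup>2 - 1) *\<^sub>R (u (p k t) * cnj (v (p k t)))" for k t
  have cont: "continuous_on UNIV (\<lambda>t. f (p k t))" if "bdd_holo f" for f k
    unfolding p_def by (intro continuous_on_circle that radii)
  have uv: "cmod (u (p k t) * cnj (v (p k t))) \<le> A * B" for k t
    using A(1) by (auto simp: norm_mult intro!: mult_mono A(2) B(2) p)
  have bound: "norm (D k t) \<le> (C\<^sup>2 + 1) * (A * B)" for k t
  proof -
    have "\<bar>(cmod (\<theta> (p k t)))\<^sup>2 - 1\<bar> \<le> C\<^sup>2 + 1"
      using power_mono[OF C(2)[OF p[of k t]] norm_ge_zero, of 2] zero_le_power2[of "cmod (\<theta> (p k t))"] 
      unfolding abs_le_iff by (intro conjI) linarith+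
    thus ?thesis unfolding D_def norm_scaleR by (intro mult_mono uv) auto
  qed
  have "(\<lambda>k. \<integral>t. D k t \<partial>circ) \<longlonglongrightarrow> (\<integral>t. 0 \<partial>circ)"
  proof (rule integral_dominated_convergence[where w = "\<lambda>_. (C\<^sup>2 + 1) * (A * B)"])
    show "D k \<in> borel_measurable circ" for k
      unfolding D_def by (intro borel_measurable_circ continuous_intros cont th u v)
    show "AE t in circ. (\<lambda>k. D k t) \<longlonglongrightarrow> 0"
      using inner_function_boundary[OF \<theta>]
    proof eventually_elim
      case (elim t)
      have "(\<lambda>k. \<bar>(cmod (\<theta> (p k t)))\<^sup>2 - 1\<bar> * (A * B)) \<longlonglongrightarrow> \<bar>1\<^sup>2 - 1\<bar> * (A * B)"
        using elim unfolding p_def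
        by (intro tendsto_mult tendsto_rabs tendsto_diff tendsto_power tendsto_const)
      hence lim: "(\<lambda>k. \<bar>(cmod (\<theta> (p k t)))\<^sup>2 - 1\<bar> * (A * B)) \<longlonglongrightarrow> 0" by simp
      moreover have "norm (D k t) \<le> \<bar>(cmod (\<theta> (p k t)))\<^sup>2 - 1\<bar> * (A * B)" for k
        unfolding D_def norm_scaleR by (intro mult_left_mono uv) simp
      ultimately show ?case
        by (intro Lim_null_comparison[OF _ lim] always_eventually allI)
    qed
  qed (auto simp: bound finite_measure.integrable_const finite_measure_circ)
  hence "(\<lambda>k. (\<integral>t. D k t \<partial>circ) / of_real (2 * pi)) \<longlonglongrightarrow> 0 / of_real (2 * pi)"
    by (intro tendsto_divide tendsto_const) auto
  moreover have "(\<integral>t. D k t \<partial>circ) / of_real (2 * pi) =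
      (\<integral>t. (\<theta> (p k t) * u (p k t)) * cnj (\<theta> (p k t) * v (p k t)) \<partial>circ) / of_real (2 * pi) -
      (\<integral>t. u (p k t) * cnj (v (p k t)) \<partial>circ) / of_real (2 * pi)" for k
  proof -
    have "integrable circ (\<lambda>t. u (p k t) * cnj (v (p k t)))"
      by (rule integrable_circ[OF _ uv]) (intro continuous_intros cont u v)
    moreover have "integrable circ (\<lambda>t. (\<theta> (p k t) * u (p k t)) * cnj (\<theta> (p k t) * v (p k t)))"
    proof (rule integrable_circ)
      show "cmod ((\<theta> (p k t) * u (p k t)) * cnj (\<theta> (p k t) * v (p k t))) \<le> (C * A) * (C * B)" for t
        unfolding norm_mult complex_mod_cnj using A(1) B(1) C(1) by (intro mult_mono A(2) B(2) C(2) p) auto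
    qed (intro continuous_intros cont u v th)
    moreover have "D k t = (\<theta> (p k t) * u (p k t)) * cnj (\<theta> (p k t) * v (p k t)) - u (p k t) * cnj (v (p k t))" for t
      unfolding D_def scaleR_conv_of_real of_real_diff complex_norm_square
      by (simp add: algebra_simps)
    ultimately show ?thesis by (simp add: diff_divide_distrib)
  qed
  ultimately have lim0: "(\<lambda>k. (\<integral>t. (\<theta> (p k t) * u (p k t)) * cnj (\<theta> (p k t) * v (p k t)) \<partial>circ) / of_real (2 * pi) -
      (\<integral>t. u (p k t) * cnj (v (p k t)) \<partial>circ) / of_real (2 * pi)) \<longlonglongrightarrow> 0"
    by (simp only: div_0)
  have "(\<lambda>k. (\<integral>t. (\<theta> (p k t) * u (p k t)) * cnj (\<theta> (p k t) * v (p k t)) \<partial>circ) / of_real (2 * pi) -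
      (\<integral>t. u (p k t) * cnj (v (p k t)) \<partial>circ) / of_real (2 * pi)) \<longlonglongrightarrow>
      h1_inner (\<lambda>z. \<theta> z * u z) (\<lambda>z. \<theta> z * v z) - h1_inner u v"
    unfolding p_def by (intro tendsto_diff h1_inner_eq_limit bdd_holo_mult th u v)
  from LIMSEQ_unique[OF this lim0] show ?thesis by simp
qed

section \<open>Model space kernels of an inner function\<close>

lemma h1_inner_eqI:
  "bdd_holo u \<Longrightarrow> bdd_holo v \<Longrightarrow>
    ((\<lambda>n. coeffs1 u n * cnj (coeffs1 v n)) has_sum s) UNIV \<Longrightarrow> h1_inner u v = s"
  using h1_inner_has_sum has_sum_unique by blast

lemma h1_inner_commute: "h1_inner u v = cnj (h1_inner v u)"
  by (simp add: h1_inner_def mult.commute flip: infsum_cnj)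

lemma h1_inner_diff_cmult_left:
  assumes "bdd_holo u" "bdd_holo v" "bdd_holo w"
  shows "h1_inner (\<lambda>z. u z - c * v z) w = h1_inner u w - c * h1_inner v w"
proof (rule h1_inner_eqI)
  have "((\<lambda>n. coeffs1 u n * cnj (coeffs1 w n) + - c * (coeffs1 v n * cnj (coeffs1 w n)))
      has_sum h1_inner u w + - c * h1_inner v w) UNIV"
    by (intro has_sum_add has_sum_cmult_right h1_inner_has_sum assms)
  thus "((\<lambda>n. coeffs1 (\<lambda>z. u z - c * v z) n * cnj (coeffs1 w n))
      has_sum h1_inner u w - c * h1_inner v w) UNIV"
    by (simp add: coeffs1_diff_cmult assms algebra_simps)
qed (intro assms bdd_holo_diff bdd_holo_mult bdd_holo_const)+

lemma h1_inner_diff_cmult_right: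
  assumes "bdd_holo u" "bdd_holo v" "bdd_holo w"
  shows "h1_inner w (\<lambda>z. u z - c * v z) = h1_inner w u - cnj c * h1_inner w v"
  using h1_inner_commute[of w "\<lambda>z. u z - c * v z"] h1_inner_commute[of w u] h1_inner_commute[of w v]
  unfolding h1_inner_diff_cmult_left[OF assms] by (metis complex_cnj_diff complex_cnj_mult)

lemma h1_inner_self_has_sum:
  "bdd_holo u \<Longrightarrow> ((\<lambda>n. (cmod (coeffs1 u n))\<^sup>2) has_sum Re (h1_inner u u)) UNIV"
  using has_sum_Re[OF h1_inner_has_sum[of u u]]
  by (simp only: complex_norm_square[symmetric] Re_complex_of_real)

text \<open>A weak form of the Cauchy-Schwarz inequality, from \<open>2 \<bar>a b\<bar> \<le> \<bar>a\<bar>\<^sup>2 + \<bar>b\<bar>\<^sup>2\<close>. It suffices for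
  bounding a sequence uniformly.\<close>

lemma cmod_h1_inner_le:
  assumes "bdd_holo u" "bdd_holo v"
  shows "cmod (h1_inner u v) \<le> (Re (h1_inner u u) + Re (h1_inner v v)) / 2"
proof -
  have "((\<lambda>n. ((cmod (coeffs1 u n))\<^sup>2 + (cmod (coeffs1 v n))\<^sup>2) * (1 / 2)) has_sum
      (Re (h1_inner u u) + Re (h1_inner v v)) * (1 / 2)) UNIV"
    by (intro has_sum_cmult_left has_sum_add h1_inner_self_has_sum assms)
  hence "norm (h1_inner u v) \<le> (Re (h1_inner u u) + Re (h1_inner v v)) * (1 / 2)"
  proof (rule norm_infsum_le[OF h1_inner_has_sum[OF assms]])
    fix n
    show "norm (coeffs1 u n * cnj (coeffs1 v n)) \<le> ((cmod (coeffs1 u n))\<^sup>2 + (cmod (coeffs1 v n))\<^sup>2) * (1 / 2)"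
      using sum_squares_bound[of "cmod (coeffs1 u n)" "cmod (coeffs1 v n)"] by (simp add: norm_mult)
  qed
  thus ?thesis by simp
qed

definition szego :: "complex \<Rightarrow> complex \<Rightarrow> complex" where
  "szego a z = 1 / (1 - cnj a * z)"

lemma szego_denom:
  assumes "a \<in> disk" "z \<in> disk"
  shows "cmod (cnj a * z) < 1" "1 - cnj a * z \<noteq> 0"
proof -
  show *: "cmod (cnj a * z) < 1"
    using assms mult_strict_mono'[of "cmod a" 1 "cmod z" 1] by (simp add: norm_mult)
  show "1 - cnj a * z \<noteq> 0"
    using * by auto
qed

lemma szego_cnj: "cnj (szego a b) = szego b a"
  by (simp add: szego_def mult.commute)

lemma szego_has_sum:
  assumes "a \<in> disk" "z \<in> disk"
  shows "((\<lambda>n. cnj a ^ n * z ^ n) has_sum szego a z) UNIV"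
  unfolding power_mult_distrib[symmetric] szego_def
  by (rule norm_summable_imp_has_sum)
     (use szego_denom[OF assms] in \<open>auto simp: norm_power intro!: geometric_sums summable_geometric\<close>)

lemma bdd_holo_szego:
  assumes a: "a \<in> disk"
  shows "bdd_holo (szego a)"
proof (rule bdd_holoI)
  show "szego a holomorphic_on disk"
    unfolding szego_def[abs_def] using szego_denom[OF a] by (intro holomorphic_intros)
  show "cmod (szego a z) \<le> 1 / (1 - cmod a)" if z: "z \<in> disk" for z
  proof -
    have "1 - cmod a \<le> 1 - cmod (cnj a * z)"
      using z a mult_left_le[of "cmod z" "cmod a"] by (simp add: norm_mult)
    also have "\<dots> \<le> cmod (1 - cnj a * z)"
      using norm_triangle_ineq2[of 1 "cnj a * z"] by simp
    finally show ?thesis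
      unfolding szego_def norm_divide using a by (simp add: frac_le)
  qed
qed

lemma coeffs1_szego: "a \<in> disk \<Longrightarrow> coeffs1 (szego a) = (\<lambda>n. cnj a ^ n)"
  by (rule coeffs1_eqI) (rule szego_has_sum)

lemma h1_inner_szego:
  assumes "bdd_holo u" "a \<in> disk"
  shows "h1_inner u (szego a) = u a"
  by (rule h1_inner_eqI)
     (use assms coeffs1_has_sum in \<open>simp_all add: bdd_holo_szego coeffs1_szego\<close>)

lemma h1_inner_mult_inner_function_power:
  assumes "inner_function \<theta>" "bdd_holo u" "bdd_holo v"
  shows "h1_inner (\<lambda>z. \<theta> z ^ n * u z) (\<lambda>z. \<theta> z ^ n * v z) = h1_inner u v"
proof (induction n)
  case (Suc n)
  show ?case
    using Suc h1_inner_mult_inner_function[OF assms(1), of "\<lambda>z. \<theta> z ^ n * u z" "\<lambda>z. \<theta> z ^ n * v z"]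
    by (simp add: assms bdd_holo_mult bdd_holo_power inner_function_bdd_holo mult.assoc)
qed simp

text \<open>Boundary modulus 1 forces modulus at most 1 inside: the powers \<open>\<theta>\<^sup>n\<close> all have the same norm,
  and evaluation at a is pairing with the Szego kernel, so \<open>\<bar>\<theta> a\<bar>\<^sup>n\<close> is bounded in n.\<close>

lemma inner_function_le_1:
  assumes \<theta>: "inner_function \<theta>" and a: "a \<in> disk"
  shows "cmod (\<theta> a) \<le> 1"
proof (rule ccontr)
  assume "\<not> cmod (\<theta> a) \<le> 1"
  define C where "C = (Re (h1_inner (\<lambda>_. 1) (\<lambda>_. 1)) + Re (h1_inner (szego a) (szego a))) / 2"
  from \<open>\<not> cmod (\<theta> a) \<le> 1\<close> obtain n where "C < cmod (\<theta> a) ^ n"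
    using real_arch_pow[of "cmod (\<theta> a)" C] by auto
  moreover have "bdd_holo (\<lambda>z. \<theta> z ^ n * 1)"
    using \<theta> by (simp add: bdd_holo_power inner_function_bdd_holo)
  hence "cmod (\<theta> a ^ n * 1) \<le> C"
    using cmod_h1_inner_le[of "\<lambda>z. \<theta> z ^ n * 1" "szego a"] a
      h1_inner_mult_inner_function_power[OF \<theta> bdd_holo_const bdd_holo_const, of n 1 1]
    by (simp add: C_def bdd_holo_szego h1_inner_szego)
  ultimately show False by (simp add: norm_power)
qed

text \<open>The value 1 of the modulus would be an interior maximum.\<close>

lemma inner_function_maps_disk:
  assumes \<theta>: "inner_function \<theta>" and nc: "\<not> \<theta> constant_on disk" and a: "a \<in> disk"
  shows "\<theta> a \<in> disk"
proof (rule ccontr)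
  assume "\<theta> a \<notin> disk"
  hence "cmod (\<theta> z) \<le> cmod (\<theta> a)" if "z \<in> disk" for z
    using inner_function_le_1[OF \<theta> that] by simp
  hence "\<theta> constant_on disk"
    using maximum_modulus_principle[of \<theta> disk disk a] bdd_holo_holomorphic[OF inner_function_bdd_holo[OF \<theta>]] a
    by auto
  with nc show False by simp
qed

text \<open>The reproducing kernel of the model space, written as the Szego kernel minus its projection to
  the range of multiplication by \<theta>; the closed form is in \<open>model_kernel_eq\<close>.\<close>

definition model_kernel :: "(complex \<Rightarrow> complex) \<Rightarrow> complex \<Rightarrow> complex \<Rightarrow> complex" where
  "model_kernel \<theta> a z = szego a z - cnj (\<theta> a) * (\<theta> z * szego a z)"

lemma model_kernel_eq: "model_kernel \<theta> a z = (1 - cnj (\<theta> a) * \<theta> z) / (1 - cnj a * z)"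
  by (simp add: model_kernel_def szego_def diff_divide_distrib)

lemma bdd_holo_model_kernel: "inner_function \<theta> \<Longrightarrow> a \<in> disk \<Longrightarrow> bdd_holo (model_kernel \<theta> a)"
  unfolding model_kernel_def[abs_def]
  by (intro bdd_holo_diff bdd_holo_mult bdd_holo_const bdd_holo_szego inner_function_bdd_holo)

text \<open>The kernel of the model space at b is orthogonal to every multiple of \<theta>. Expanding it as in its
  definition leaves pairings with \<open>szego b\<close> and with \<open>\<theta> \<cdot> szego b\<close>; the first is an evaluation,
  and in the second a common factor \<theta> cancels, for d = 0 after the kernel at a has been
  expanded as well.\<close>

lemma model_kernel_gram_le:
  assumes \<theta>: "inner_function \<theta>" and a: "a \<in> disk" and b: "b \<in> disk"
  shows "h1_inner (\<lambda>z. \<theta> z ^ d * model_kernel \<theta> a z) (model_kernel \<theta> b) = (if d = 0 then model_kernel \<theta> a b else 0)"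
proof -
  note th = inner_function_bdd_holo[OF \<theta>]
  note sa = bdd_holo_szego[OF a] note sb = bdd_holo_szego[OF b]
  note ka = bdd_holo_model_kernel[OF \<theta> a]
  have eval: "h1_inner (\<lambda>z. \<theta> z ^ e * model_kernel \<theta> a z) (szego b) = \<theta> b ^ e * model_kernel \<theta> a b" for e
    by (rule h1_inner_szego) (intro bdd_holo_mult bdd_holo_power th ka b)+
  have "h1_inner (\<lambda>z. \<theta> z ^ d * model_kernel \<theta> a z) (model_kernel \<theta> b) =
      \<theta> b ^ d * model_kernel \<theta> a b - \<theta> b * h1_inner (\<lambda>z. \<theta> z ^ d * model_kernel \<theta> a z) (\<lambda>z. \<theta> z * szego b z)"
    unfolding model_kernel_def[of \<theta> b, abs_def]
    by (subst h1_inner_diff_cmult_right)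
       (simp_all add: eval bdd_holo_mult bdd_holo_power th ka sb)
  moreover have "h1_inner (\<lambda>z. \<theta> z ^ d * model_kernel \<theta> a z) (\<lambda>z. \<theta> z * szego b z) =
      (case d of 0 \<Rightarrow> 0 | Suc e \<Rightarrow> \<theta> b ^ e * model_kernel \<theta> a b)"
  proof (cases d)
    case 0
    have "h1_inner (model_kernel \<theta> a) (\<lambda>z. \<theta> z * szego b z) =
        h1_inner (szego a) (\<lambda>z. \<theta> z * szego b z) -
        cnj (\<theta> a) * h1_inner (\<lambda>z. \<theta> z * szego a z) (\<lambda>z. \<theta> z * szego b z)"
      unfolding model_kernel_def[abs_def]
      by (intro h1_inner_diff_cmult_left bdd_holo_mult th sa sb)
    also have "h1_inner (szego a) (\<lambda>z. \<theta> z * szego b z) = cnj (\<theta> a * szego b a)"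
      using h1_inner_szego[OF bdd_holo_mult[OF th sb] a]
      by (subst h1_inner_commute) simp
    also have "h1_inner (\<lambda>z. \<theta> z * szego a z) (\<lambda>z. \<theta> z * szego b z) = szego a b"
      by (simp add: h1_inner_mult_inner_function \<theta> sa sb h1_inner_szego[OF sa b])
    finally show ?thesis using 0 by (simp add: szego_cnj)
  next
    case (Suc e)
    have "h1_inner (\<lambda>z. \<theta> z * (\<theta> z ^ e * model_kernel \<theta> a z)) (\<lambda>z. \<theta> z * szego b z) =
        h1_inner (\<lambda>z. \<theta> z ^ e * model_kernel \<theta> a z) (szego b)"
      by (intro h1_inner_mult_inner_function \<theta> bdd_holo_mult bdd_holo_power th ka sb)
    thus ?thesis using Suc by (simp add: eval mult.assoc)
  qed
  ultimately show ?thesis by (cases d) auto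
qed

lemma model_kernel_cnj: "cnj (model_kernel \<theta> a b) = model_kernel \<theta> b a"
  by (simp add: model_kernel_eq mult.commute)

text \<open>Cancelling the smaller of the two powers reduces to \<open>model_kernel_gram_le\<close>. The spaces \<open>\<theta>\<^sup>n\<close> times the
  model space are thus pairwise orthogonal copies of the model space.\<close>

lemma model_kernel_gram:
  assumes \<theta>: "inner_function \<theta>" and a: "a \<in> disk" and b: "b \<in> disk"
  shows "h1_inner (\<lambda>z. \<theta> z ^ m * model_kernel \<theta> a z) (\<lambda>z. \<theta> z ^ n * model_kernel \<theta> b z) =
     (if m = n then model_kernel \<theta> a b else 0)"
proof -
  have le: "h1_inner (\<lambda>z. \<theta> z ^ m * model_kernel \<theta> a z) (\<lambda>z. \<theta> z ^ n * model_kernel \<theta> b z) =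
     (if m = n then model_kernel \<theta> a b else 0)" if "n \<le> m" "a \<in> disk" "b \<in> disk" for a b m n
  proof -
    obtain d where d: "m = n + d" using \<open>n \<le> m\<close> le_Suc_ex by blast
    have "h1_inner (\<lambda>z. \<theta> z ^ n * (\<theta> z ^ d * model_kernel \<theta> a z)) (\<lambda>z. \<theta> z ^ n * model_kernel \<theta> b z) =
        h1_inner (\<lambda>z. \<theta> z ^ d * model_kernel \<theta> a z) (model_kernel \<theta> b)"
      by (intro h1_inner_mult_inner_function_power \<theta> bdd_holo_mult bdd_holo_power
            inner_function_bdd_holo bdd_holo_model_kernel that)
    thus ?thesis using model_kernel_gram_le[OF \<theta> that(2,3), of d] by (simp add: d power_add mult.assoc)
  qed
  show ?thesis
  proof (cases "n \<le> m")
    case False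
    hence "h1_inner (\<lambda>z. \<theta> z ^ n * model_kernel \<theta> b z) (\<lambda>z. \<theta> z ^ m * model_kernel \<theta> a z) = 0"
      using le[of m n b a] a b by simp
    thus ?thesis using False h1_inner_commute by (metis complex_cnj_zero le_refl)
  qed (rule le[OF _ a b])
qed

section \<open>Tensor products and convergent series in the Hardy space of the bidisk\<close>

text \<open>The product is cut off outside the bidisk, following the convention for elements of the Hardy
  space.\<close>

definition tens :: "(complex \<Rightarrow> complex) \<Rightarrow> (complex \<Rightarrow> complex) \<Rightarrow> complex \<times> complex \<Rightarrow> complex" where
  "tens u v = (\<lambda>(z, w). if (z, w) \<in> bidisk then u z * v w else 0)"

lemma has_sum_product:
  fixes f :: "'a \<Rightarrow> complex" and g :: "'b \<Rightarrow> complex"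
  assumes f: "(f has_sum s) A" and g: "(g has_sum t) B"
  shows "((\<lambda>k. f (fst k) * g (snd k)) has_sum s * t) (A \<times> B)"
proof (rule has_sum_SigmaI)
  show "((\<lambda>y. f (fst (x, y)) * g (snd (x, y))) has_sum f x * t) B" for x
    using has_sum_cmult_right[OF g] by simp
  show "((\<lambda>x. f x * t) has_sum s * t) A"
    by (rule has_sum_cmult_left[OF f])
  have nf: "(\<lambda>x. norm (f x)) summable_on A" and ng: "(\<lambda>y. norm (g y)) summable_on B"
    using f g by (simp_all add: has_sum_imp_summable flip: summable_on_iff_abs_summable_on_complex)
  have "(\<lambda>k. norm (f (fst k) * g (snd k))) summable_on A \<times> B"
  proof (rule summable_on_SigmaI)
    show "((\<lambda>y. norm (f (fst (x, y)) * g (snd (x, y)))) has_sum norm (f x) * (\<Sum>\<^sub>\<infinity>y\<in>B. norm (g y))) B" for x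
      using has_sum_cmult_right[OF has_sum_infsum[OF ng], of "norm (f x)"] by (simp add: norm_mult)
    show "(\<lambda>x. norm (f x) * (\<Sum>\<^sub>\<infinity>y\<in>B. norm (g y))) summable_on A"
      by (rule summable_on_cmult_left[OF nf])
  qed simp
  thus "(\<lambda>k. f (fst k) * g (snd k)) summable_on A \<times> B"
    by (rule abs_summable_summable)
qed

lemma
  assumes u: "bdd_holo u" and v: "bdd_holo v"
  shows tens_hardy2: "tens u v \<in> hardy2"
    and coeffs2_tens: "coeffs2 (tens u v) = (\<lambda>k. coeffs1 u (fst k) * coeffs1 v (snd k))"
proof -
  have of: "((\<lambda>n. complex_of_real ((cmod (coeffs1 u n))\<^sup>2)) has_sum of_real s) UNIV"
    if "((\<lambda>n. (cmod (coeffs1 u n))\<^sup>2) has_sum s) UNIV" for u s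
    using that by (rule has_sum_of_real)
  have "((\<lambda>k. complex_of_real ((cmod (coeffs1 u (fst k)))\<^sup>2) * of_real ((cmod (coeffs1 v (snd k)))\<^sup>2))
      has_sum of_real (Re (h1_inner u u)) * of_real (Re (h1_inner v v))) (UNIV \<times> UNIV)"
    by (intro has_sum_product of h1_inner_self_has_sum u v)
  hence "(\<lambda>k. complex_of_real ((cmod (coeffs1 u (fst k) * coeffs1 v (snd k)))\<^sup>2)) summable_on UNIV"
    by (auto simp: norm_mult power_mult_distrib dest: has_sum_imp_summable)
  hence "(\<lambda>k. Re (complex_of_real ((cmod (coeffs1 u (fst k) * coeffs1 v (snd k)))\<^sup>2))) summable_on UNIV"
    by (rule summable_on_Re)
  hence 1: "(\<lambda>k. (cmod (coeffs1 u (fst k) * coeffs1 v (snd k)))\<^sup>2) summable_on UNIV"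
    by (simp only: Re_complex_of_real)
  have 2: "((\<lambda>k. coeffs1 u (fst k) * coeffs1 v (snd k) * monom2 p k) has_sum tens u v p) UNIV"
    if "p \<in> bidisk" for p
  proof -
    obtain z w where p: "p = (z, w)" "z \<in> disk" "w \<in> disk" using \<open>p \<in> bidisk\<close> by (cases p) auto
    have "((\<lambda>k. coeffs1 u (fst k) * z ^ fst k * (coeffs1 v (snd k) * w ^ snd k)) has_sum u z * v w) (UNIV \<times> UNIV)"
      by (rule has_sum_product[OF coeffs1_has_sum[OF u p(2)] coeffs1_has_sum[OF v p(3)]])
    thus ?thesis using p by (simp add: tens_def monom2_def mult_ac)
  qed
  show "tens u v \<in> hardy2"
    by (rule hardy2I(1)[OF 1 2]) (auto simp: tens_def split: if_splits)
  show "coeffs2 (tens u v) = (\<lambda>k. coeffs1 u (fst k) * coeffs1 v (snd k))"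
    by (rule hardy2I(2)[OF 1 2]) (auto simp: tens_def split: if_splits)
qed

lemma h2_inner_tens:
  assumes "bdd_holo u" "bdd_holo v" "bdd_holo u'" "bdd_holo v'"
  shows "h2_inner (tens u v) (tens u' v') = h1_inner u u' * h1_inner v v'"
proof (rule h2_inner_eqI)
  have "((\<lambda>k. coeffs1 u (fst k) * cnj (coeffs1 u' (fst k)) * (coeffs1 v (snd k) * cnj (coeffs1 v' (snd k))))
      has_sum h1_inner u u' * h1_inner v v') (UNIV \<times> UNIV)"
    by (intro has_sum_product h1_inner_has_sum assms)
  thus "((\<lambda>k. coeffs2 (tens u v) k * cnj (coeffs2 (tens u' v') k)) has_sum h1_inner u u' * h1_inner v v') UNIV"
    by (simp add: coeffs2_tens assms mult_ac)
qed (intro tens_hardy2 assms)+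

definition szego2 :: "complex \<times> complex \<Rightarrow> complex \<times> complex \<Rightarrow> complex" where
  "szego2 q = tens (szego (fst q)) (szego (snd q))"

lemma szego2_hardy2: "q \<in> bidisk \<Longrightarrow> szego2 q \<in> hardy2"
  unfolding szego2_def by (intro tens_hardy2 bdd_holo_szego) (auto simp: mem_Times_iff)

text \<open>Point evaluations are pairings with the Szego kernel, hence continuous.\<close>

lemma h2_inner_szego2:
  assumes "f \<in> hardy2" "q \<in> bidisk"
  shows "h2_inner f (szego2 q) = f q"
proof (rule h2_inner_eqI)
  have "coeffs2 (szego2 q) = (\<lambda>k. cnj (monom2 q k))"
    using assms(2) unfolding szego2_def
    by (subst coeffs2_tens) (auto simp: bdd_holo_szego coeffs1_szego monom2_def mem_Times_iff)
  thus "((\<lambda>k. coeffs2 f k * cnj (coeffs2 (szego2 q) k)) has_sum f q) UNIV"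
    using coeffs2_has_sum[OF assms] by simp
qed (use assms szego2_hardy2 in auto)

text \<open>Unconditional convergence in norm of a family of elements of the Hardy space.\<close>

definition h2_has_sum :: "('i \<Rightarrow> complex \<times> complex \<Rightarrow> complex) \<Rightarrow> (complex \<times> complex \<Rightarrow> complex) \<Rightarrow> bool" where
  "h2_has_sum v V \<longleftrightarrow> V \<in> hardy2 \<and> (\<forall>i. v i \<in> hardy2) \<and>
     ((\<lambda>S. h2_norm (\<lambda>p. V p - (\<Sum>i\<in>S. v i p))) \<longlongrightarrow> 0) (finite_subsets_at_top UNIV)"

text \<open>Continuity of the inner product in its first argument.\<close>

lemma h2_has_sum_inner:
  assumes "h2_has_sum v V" "h \<in> hardy2"
  shows "((\<lambda>i. h2_inner (v i) h) has_sum h2_inner V h) UNIV"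
proof -
  have V: "V \<in> hardy2" and v: "\<And>i. v i \<in> hardy2"
    and lim: "((\<lambda>S. h2_norm (\<lambda>p. V p - (\<Sum>i\<in>S. v i p))) \<longlongrightarrow> 0) (finite_subsets_at_top UNIV)"
    using assms(1) by (auto simp: h2_has_sum_def)
  have "((\<lambda>S. h2_norm (\<lambda>p. V p - (\<Sum>i\<in>S. v i p)) * h2_norm h) \<longlongrightarrow> 0 * h2_norm h) (finite_subsets_at_top UNIV)"
    by (intro tendsto_mult_right lim)
  hence lim': "((\<lambda>S. h2_norm (\<lambda>p. V p - (\<Sum>i\<in>S. v i p)) * h2_norm h) \<longlongrightarrow> 0) (finite_subsets_at_top UNIV)"
    by simp
  have "norm ((\<Sum>i\<in>S. h2_inner (v i) h) - h2_inner V h) \<le> h2_norm (\<lambda>p. V p - (\<Sum>i\<in>S. v i p)) * h2_norm h" for S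
  proof -
    have "h2_inner (\<lambda>p. V p - (\<Sum>i\<in>S. v i p)) h = h2_inner V h - (\<Sum>i\<in>S. h2_inner (v i) h)"
      by (simp add: h2_inner_diff_left h2_inner_sum_left V v hardy2_sum assms)
    thus ?thesis
      using h2_cauchy_schwarz[OF hardy2_diff[OF V hardy2_sum[of S v]] assms(2)] v
      by (simp add: norm_minus_commute)
  qed
  hence "((\<lambda>S. (\<Sum>i\<in>S. h2_inner (v i) h) - h2_inner V h) \<longlongrightarrow> 0) (finite_subsets_at_top UNIV)"
    by (intro Lim_null_comparison[OF _ lim'] always_eventually allI)
  thus ?thesis by (simp add: has_sum_def LIM_zero_iff)
qed

lemma h2_has_sum_eval:
  assumes "h2_has_sum v V" "p \<in> bidisk"
  shows "((\<lambda>i. v i p) has_sum V p) UNIV"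
  using h2_has_sum_inner[OF assms(1) szego2_hardy2[OF assms(2)]] assms
  by (simp add: h2_inner_szego2 h2_has_sum_def)

lemma h2_has_sum_in_closure:
  assumes "h2_has_sum v V" "\<And>S. finite S \<Longrightarrow> (\<lambda>p. \<Sum>i\<in>S. v i p) \<in> X"
  shows "V \<in> h2_closure X"
  unfolding h2_closure_def
proof (intro CollectI conjI allI impI)
  show "V \<in> hardy2" using assms(1) by (simp add: h2_has_sum_def)
  fix e :: real assume "e > 0"
  have "((\<lambda>S. h2_norm (\<lambda>p. V p - (\<Sum>i\<in>S. v i p))) \<longlongrightarrow> 0) (finite_subsets_at_top UNIV)"
    using assms(1) by (simp add: h2_has_sum_def)
  hence "eventually (\<lambda>S. h2_norm (\<lambda>p. V p - (\<Sum>i\<in>S. v i p)) < e) (finite_subsets_at_top UNIV)"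
    using \<open>e > 0\<close> by (rule order_tendstoD(2))
  then obtain S where "finite S" "h2_norm (\<lambda>p. V p - (\<Sum>i\<in>S. v i p)) < e"
    unfolding eventually_finite_subsets_at_top by blast
  thus "\<exists>g\<in>X. h2_norm (\<lambda>p. V p - g p) < e"
    using assms(2)[of S] by (intro bexI[of _ "\<lambda>p. \<Sum>i\<in>S. v i p"])
qed

text \<open>For a real family the sums over the nonnegative and over the negative members are both bounded,
  which gives absolute summability; a complex family is treated through its real and imaginary
  parts.\<close>

lemma summable_on_of_bounded_partial_sums:
  fixes x :: "'i \<Rightarrow> complex"
  assumes "\<And>S. finite S \<Longrightarrow> cmod (\<Sum>i\<in>S. x i) \<le> C"
  shows "x summable_on UNIV"
proof -
  have re: "(\<lambda>i. \<bar>y i\<bar>) summable_on UNIV"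
    if y: "\<And>S. finite S \<Longrightarrow> \<bar>\<Sum>i\<in>S. y i\<bar> \<le> C" for y :: "'i \<Rightarrow> real"
  proof (rule nonneg_bdd_above_summable_on)
    show "bdd_above (sum (\<lambda>i. \<bar>y i\<bar>) ` {F. F \<subseteq> UNIV \<and> finite F})"
    proof (rule bdd_aboveI2)
      fix F :: "'i set" assume "F \<in> {F. F \<subseteq> UNIV \<and> finite F}"
      hence F: "finite F" by simp
      have "(\<Sum>i\<in>F. \<bar>y i\<bar>) = (\<Sum>i\<in>{i\<in>F. y i \<ge> 0}. y i) - (\<Sum>i\<in>{i\<in>F. \<not> y i \<ge> 0}. y i)"
        unfolding sum.inter_filter[OF F] sum_subtractf[symmetric] by (rule sum.cong) auto
      also have "\<dots> \<le> C + C"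
        using y[of "{i\<in>F. y i \<ge> 0}"] y[of "{i\<in>F. \<not> y i \<ge> 0}"] F by simp
      finally show "(\<Sum>i\<in>F. \<bar>y i\<bar>) \<le> C + C" .
    qed
  qed simp
  have "\<bar>\<Sum>i\<in>S. Re (x i)\<bar> \<le> C" "\<bar>\<Sum>i\<in>S. Im (x i)\<bar> \<le> C" if "finite S" for S
    using assms[OF that] abs_Re_le_cmod[of "\<Sum>i\<in>S. x i"] abs_Im_le_cmod[of "\<Sum>i\<in>S. x i"]
    unfolding Re_sum Im_sum by linarith+
  hence "(\<lambda>i. \<bar>Re (x i)\<bar>) summable_on UNIV" "(\<lambda>i. \<bar>Im (x i)\<bar>) summable_on UNIV"
    by (simp_all only: re)
  hence "(\<lambda>i. \<bar>Re (x i)\<bar> + \<bar>Im (x i)\<bar>) summable_on UNIV"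
    by (rule summable_on_add)
  hence "(\<lambda>i. norm (x i)) summable_on UNIV"
    by (rule Infinite_Sum.abs_summable_on_comparison_test') (rule cmod_le)
  thus ?thesis by (rule abs_summable_summable)
qed

text \<open>Completeness of the Hardy space, in the form of a criterion for unconditional convergence. The
  bound on the squared norms of finite sums covers both orthogonal series (with equality) and
  absolutely convergent ones. Each coefficient converges by
  \<open>summable_on_of_bounded_partial_sums\<close>, and the square norm of a remainder is
  estimated on finite sets of coefficients before passing to the limit.\<close>

lemma h2_series_converges:
  assumes v: "\<And>i. v i \<in> hardy2" and t: "t summable_on (UNIV :: 'i set)"
    and bound: "\<And>S. finite S \<Longrightarrow> (h2_norm (\<lambda>p. \<Sum>i\<in>S. v i p))\<^sup>2 \<le> (\<Sum>i\<in>S. t i)"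
  obtains V where "h2_has_sum v V"
proof -
  define T where "T = (\<Sum>\<^sub>\<infinity>i. t i)"
  define A where "A k = (\<Sum>\<^sub>\<infinity>i. coeffs2 (v i) k)" for k
  have t0: "0 \<le> t i" for i using order_trans[OF zero_le_power2 bound[of "{i}"]] by simp
  have T: "(\<Sum>i\<in>S. t i) \<le> T" if "finite S" for S
    unfolding T_def by (rule finite_sum_le_infsum) (use t t0 that in auto)
  have partial: "(\<Sum>k\<in>J. (cmod (\<Sum>i\<in>S. coeffs2 (v i) k))\<^sup>2) \<le> (\<Sum>i\<in>S. t i)"
    if "finite S" "finite J" for S J
  proof -
    have "(\<Sum>k\<in>J. (cmod (coeffs2 (\<lambda>p. \<Sum>i\<in>S. v i p) k))\<^sup>2) \<le> (h2_norm (\<lambda>p. \<Sum>i\<in>S. v i p))\<^sup>2"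
      by (rule finite_sum_le_has_sum[OF h2_norm_sq_has_sum[OF hardy2_sum[of S v]] \<open>finite J\<close>]) (use v in auto)
    with bound[OF \<open>finite S\<close>] show ?thesis by (simp add: coeffs2_sum v)
  qed
  have "(\<lambda>i. coeffs2 (v i) k) summable_on UNIV" for k
  proof (rule summable_on_of_bounded_partial_sums)
    fix S :: "'i set" assume S: "finite S"
    have "(cmod (\<Sum>i\<in>S. coeffs2 (v i) k))\<^sup>2 \<le> T"
      using partial[OF S, of "{k}"] T[OF S] by simp
    thus "cmod (\<Sum>i\<in>S. coeffs2 (v i) k) \<le> sqrt T"
      by (rule real_le_rsqrt)
  qed
  hence A: "((\<lambda>i. coeffs2 (v i) k) has_sum A k) UNIV" for k
    unfolding A_def by (rule has_sum_infsum)
  have tail: "(\<Sum>k\<in>J. (cmod (A k - (\<Sum>i\<in>S. coeffs2 (v i) k)))\<^sup>2) \<le> T - (\<Sum>i\<in>S. t i)"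
    if S: "finite S" and J: "finite J" for S J
  proof (rule tendsto_upperbound)
    show "((\<lambda>S'. \<Sum>k\<in>J. (cmod ((\<Sum>i\<in>S'. coeffs2 (v i) k) - (\<Sum>i\<in>S. coeffs2 (v i) k)))\<^sup>2) \<longlongrightarrow>
        (\<Sum>k\<in>J. (cmod (A k - (\<Sum>i\<in>S. coeffs2 (v i) k)))\<^sup>2)) (finite_subsets_at_top UNIV)"
      by (intro tendsto_sum tendsto_power tendsto_norm tendsto_diff tendsto_const A[unfolded has_sum_def])
    show "\<forall>\<^sub>F S' in finite_subsets_at_top UNIV.
        (\<Sum>k\<in>J. (cmod ((\<Sum>i\<in>S'. coeffs2 (v i) k) - (\<Sum>i\<in>S. coeffs2 (v i) k)))\<^sup>2) \<le> T - (\<Sum>i\<in>S. t i)"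
      unfolding eventually_finite_subsets_at_top
    proof (intro exI[of _ S] conjI allI impI)
      fix S' assume S': "finite S' \<and> S \<subseteq> S' \<and> S' \<subseteq> UNIV"
      have "(\<Sum>i\<in>S'. f i) = (\<Sum>i\<in>S' - S. f i) + (\<Sum>i\<in>S. f i)" for f :: "'i \<Rightarrow> complex"
        using S' by (intro sum.subset_diff) auto
      hence "(\<Sum>k\<in>J. (cmod ((\<Sum>i\<in>S'. coeffs2 (v i) k) - (\<Sum>i\<in>S. coeffs2 (v i) k)))\<^sup>2) =
          (\<Sum>k\<in>J. (cmod (\<Sum>i\<in>S' - S. coeffs2 (v i) k))\<^sup>2)" by simp
      also have "\<dots> \<le> (\<Sum>i\<in>S' - S. t i)" using S' by (intro partial J) auto
      also have "\<dots> = (\<Sum>i\<in>S'. t i) - (\<Sum>i\<in>S. t i)" using S' by (intro sum_diff) auto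
      also have "\<dots> \<le> T - (\<Sum>i\<in>S. t i)" using T S' by simp
      finally show "(\<Sum>k\<in>J. (cmod ((\<Sum>i\<in>S'. coeffs2 (v i) k) - (\<Sum>i\<in>S. coeffs2 (v i) k)))\<^sup>2) \<le> T - (\<Sum>i\<in>S. t i)" .
    qed (use S in auto)
  qed simp
  have A2: "(\<lambda>k. (cmod (A k))\<^sup>2) summable_on UNIV"
  proof (rule nonneg_bdd_above_summable_on)
    show "bdd_above (sum (\<lambda>k. (cmod (A k))\<^sup>2) ` {F. F \<subseteq> UNIV \<and> finite F})"
      by (rule bdd_aboveI2[of _ _ T]) (use tail[of "{}"] in auto)
  qed simp
  define V where "V p = (if p \<in> bidisk then \<Sum>\<^sub>\<infinity>k. A k * monom2 p k else 0)" for p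
  have exp: "((\<lambda>k. A k * monom2 p k) has_sum V p) UNIV" if p: "p \<in> bidisk" for p
  proof -
    have "(\<lambda>k. (cmod (coeffs2 (szego2 p) k))\<^sup>2) summable_on UNIV"
      by (intro coeffs2_square_summable szego2_hardy2 p)
    hence "(\<lambda>k. A k * cnj (coeffs2 (szego2 p) k)) summable_on UNIV"
      by (rule square_summable_mult[OF A2])
    moreover have "cnj (coeffs2 (szego2 p) k) = monom2 p k" for k
      using p unfolding szego2_def
      by (subst coeffs2_tens) (auto simp: bdd_holo_szego coeffs1_szego monom2_def mem_Times_iff)
    ultimately show ?thesis using p by (simp add: V_def)
  qed
  have V: "V \<in> hardy2" "coeffs2 V = A"
    by (rule hardy2I[OF A2 exp], simp_all only: V_def if_False)+
  have "((\<lambda>S. h2_norm (\<lambda>p. V p - (\<Sum>i\<in>S. v i p))) \<longlongrightarrow> 0) (finite_subsets_at_top UNIV)"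
  proof (rule Lim_null_comparison)
    have "((\<lambda>S. sqrt (T - (\<Sum>i\<in>S. t i))) \<longlongrightarrow> sqrt (T - T)) (finite_subsets_at_top UNIV)"
      unfolding T_def by (intro tendsto_intros infsum_tendsto t)
    thus "((\<lambda>S. sqrt (T - (\<Sum>i\<in>S. t i))) \<longlongrightarrow> 0) (finite_subsets_at_top UNIV)" by simp
    show "\<forall>\<^sub>F S in finite_subsets_at_top UNIV. norm (h2_norm (\<lambda>p. V p - (\<Sum>i\<in>S. v i p))) \<le> sqrt (T - (\<Sum>i\<in>S. t i))"
    proof (rule eventually_finite_subsets_at_top_weakI)
      fix S :: "'i set" assume S: "finite S"
      have d: "(\<lambda>p. V p - (\<Sum>i\<in>S. v i p)) \<in> hardy2"
        by (intro hardy2_diff V hardy2_sum v)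
      have "(h2_norm (\<lambda>p. V p - (\<Sum>i\<in>S. v i p)))\<^sup>2 \<le> T - (\<Sum>i\<in>S. t i)"
      proof (rule has_sum_le_finite_sums[OF h2_norm_sq_has_sum[OF d]])
        fix F :: "(nat \<times> nat) set" assume "finite F"
        thus "(\<Sum>k\<in>F. (cmod (coeffs2 (\<lambda>p. V p - (\<Sum>i\<in>S. v i p)) k))\<^sup>2) \<le> T - (\<Sum>i\<in>S. t i)"
          using tail[OF S] by (simp add: coeffs2_diff V hardy2_sum v coeffs2_sum)
      qed
      thus "norm (h2_norm (\<lambda>p. V p - (\<Sum>i\<in>S. v i p))) \<le> sqrt (T - (\<Sum>i\<in>S. t i))"
        using h2_norm_nonneg[OF d] by (simp add: real_le_rsqrt)
    qed
  qed
  with V v show ?thesis by (intro that[of V]) (auto simp: h2_has_sum_def)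
qed

section \<open>Multiplication by the Szego kernel\<close>

text \<open>Multiplying by a monomial shifts the coefficients and fills up with zeros.\<close>

lemma has_sum_shift:
  fixes G :: "nat \<times> nat \<Rightarrow> 'a :: {comm_monoid_add, topological_space}"
  assumes g: "(g has_sum s) UNIV"
    and G: "\<And>j. G (fst j + fst k, snd j + snd k) = g j"
    and G0: "\<And>j. \<not> (fst k \<le> fst j \<and> snd k \<le> snd j) \<Longrightarrow> G j = 0"
  shows "(G has_sum s) UNIV"
proof -
  define \<sigma> where "\<sigma> j = (fst j + fst k, snd j + snd k)" for j :: "nat \<times> nat"
  have inj: "inj \<sigma>" by (auto simp: inj_def \<sigma>_def)
  have "G \<circ> \<sigma> = g" using G by (auto simp: \<sigma>_def fun_eq_iff)
  with g have "(G has_sum s) (range \<sigma>)" by (simp add: has_sum_reindex[OF inj])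
  moreover have "G j = 0" if "j \<notin> range \<sigma>" for j
  proof (rule G0, rule notI)
    assume "fst k \<le> fst j \<and> snd k \<le> snd j"
    hence "j = \<sigma> (fst j - fst k, snd j - snd k)" by (auto simp: \<sigma>_def)
    with that show False by blast
  qed
  ultimately show ?thesis
    by (subst has_sum_cong_neutral[where T = "range \<sigma>" and g = G]) auto
qed

lemma
  assumes h: "h \<in> hardy2"
  shows monom2_mult_hardy2: "(\<lambda>p. monom2 p k * h p) \<in> hardy2"
    and h2_norm_monom2_mult: "h2_norm (\<lambda>p. monom2 p k * h p) = h2_norm h"
proof -
  define a where "a j = (if fst k \<le> fst j \<and> snd k \<le> snd j
      then coeffs2 h (fst j - fst k, snd j - snd k) else 0)" for j
  have sq: "((\<lambda>j. (cmod (a j))\<^sup>2) has_sum (h2_norm h)\<^sup>2) UNIV"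
    by (rule has_sum_shift[OF h2_norm_sq_has_sum[OF h], of _ k]) (auto simp: a_def)
  have exp: "((\<lambda>j. a j * monom2 p j) has_sum monom2 p k * h p) UNIV" if p: "p \<in> bidisk" for p
    by (rule has_sum_shift[OF has_sum_cmult_right[OF coeffs2_has_sum[OF h p]], of _ k])
       (auto simp: a_def monom2_def power_add)
  note * = hardy2I[OF has_sum_imp_summable[OF sq] exp]
  show H: "(\<lambda>p. monom2 p k * h p) \<in> hardy2"
    by (rule *) (auto simp: hardy2_outside[OF h])
  have "coeffs2 (\<lambda>p. monom2 p k * h p) = a"
    by (rule *) (auto simp: hardy2_outside[OF h])
  hence "(h2_norm (\<lambda>p. monom2 p k * h p))\<^sup>2 = (h2_norm h)\<^sup>2"
    using h2_norm_sq_has_sum[OF H] sq has_sum_unique by metis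
  thus "h2_norm (\<lambda>p. monom2 p k * h p) = h2_norm h"
    using h2_norm_nonneg[OF H] h2_norm_nonneg[OF h] by simp
qed

lemma szego2_has_sum:
  assumes "q \<in> bidisk" "p \<in> bidisk"
  shows "((\<lambda>k. cnj (monom2 q k) * monom2 p k) has_sum szego2 q p) UNIV"
proof -
  have "((\<lambda>k. (cnj (fst q) ^ fst k * fst p ^ fst k) * (cnj (snd q) ^ snd k * snd p ^ snd k))
      has_sum szego (fst q) (fst p) * szego (snd q) (snd p)) (UNIV \<times> UNIV)"
    by (intro has_sum_product szego_has_sum) (use assms in \<open>auto simp: mem_Times_iff\<close>)
  thus ?thesis using assms
    by (cases p) (auto simp: szego2_def tens_def monom2_def mult_ac)
qed

lemma monom2_abs_summable:
  assumes "q \<in> bidisk"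
  shows "(\<lambda>k. cmod (monom2 q k)) summable_on UNIV"
proof -
  have geo: "((\<lambda>n. x ^ n) has_sum 1 / (1 - x)) UNIV" if "x \<in> disk" for x :: complex
    by (rule norm_summable_imp_has_sum)
       (use that in \<open>auto simp: norm_power intro!: geometric_sums summable_geometric\<close>)
  have "((\<lambda>k. fst q ^ fst k * snd q ^ snd k) has_sum 1 / (1 - fst q) * (1 / (1 - snd q))) (UNIV \<times> UNIV)"
    by (intro has_sum_product geo) (use assms in \<open>auto simp: mem_Times_iff\<close>)
  hence "(\<lambda>k. monom2 q k) summable_on UNIV"
    by (simp add: monom2_def has_sum_imp_summable)
  thus ?thesis by (simp only: summable_on_iff_abs_summable_on_complex)
qed

text \<open>Multiplication by a monomial is isometric, so expanding the Szego kernel into monomials gives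
  an absolutely convergent series.\<close>

lemma h2_has_sum_szego2_mult:
  assumes h: "h \<in> hardy2" and q: "q \<in> bidisk"
  shows "h2_has_sum (\<lambda>k p. cnj (monom2 q k) * (monom2 p k * h p)) (\<lambda>p. szego2 q p * h p)"
proof -
  define v where "v k p = cnj (monom2 q k) * (monom2 p k * h p)" for k p
  define R where "R = (\<Sum>\<^sub>\<infinity>k. cmod (monom2 q k))"
  have v: "v k \<in> hardy2" for k
    unfolding v_def[abs_def] by (intro hardy2_cmult monom2_mult_hardy2 h)
  have nv: "h2_norm (v k) = cmod (monom2 q k) * h2_norm h" for k
    unfolding v_def[abs_def] using monom2_mult_hardy2[OF h, of k] h
    by (simp add: h2_norm_cmult h2_norm_monom2_mult)
  have bound: "(h2_norm (\<lambda>p. \<Sum>k\<in>S. v k p))\<^sup>2 \<le> (\<Sum>k\<in>S. cmod (monom2 q k) * (R * (h2_norm h)\<^sup>2))"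
    if S: "finite S" for S
  proof -
    have R: "(\<Sum>k\<in>S. cmod (monom2 q k)) \<le> R"
      unfolding R_def by (rule finite_sum_le_infsum) (use monom2_abs_summable[OF q] S in auto)
    have "h2_norm (\<lambda>p. \<Sum>k\<in>S. v k p) \<le> (\<Sum>k\<in>S. cmod (monom2 q k)) * h2_norm h"
      using h2_norm_sum_le[of S v] v by (simp add: nv sum_distrib_right)
    hence "(h2_norm (\<lambda>p. \<Sum>k\<in>S. v k p))\<^sup>2 \<le> ((\<Sum>k\<in>S. cmod (monom2 q k)) * h2_norm h)\<^sup>2"
      by (intro power_mono h2_norm_nonneg hardy2_sum v)
    also have "\<dots> = (\<Sum>k\<in>S. cmod (monom2 q k)) * ((\<Sum>k\<in>S. cmod (monom2 q k)) * (h2_norm h)\<^sup>2)"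
      by (simp add: power2_eq_square mult_ac)
    also have "\<dots> \<le> (\<Sum>k\<in>S. cmod (monom2 q k)) * (R * (h2_norm h)\<^sup>2)"
      by (intro mult_left_mono mult_right_mono R) (auto intro: sum_nonneg)
    finally show ?thesis by (simp add: sum_distrib_right)
  qed
  obtain V where V: "h2_has_sum v V"
    by (rule h2_series_converges[OF v _ bound])
       (intro summable_on_cmult_left monom2_abs_summable q)
  have "V p = szego2 q p * h p" for p
  proof (cases "p \<in> bidisk")
    case True
    have "((\<lambda>k. cnj (monom2 q k) * monom2 p k * h p) has_sum szego2 q p * h p) UNIV"
      by (intro has_sum_cmult_left szego2_has_sum q True)
    moreover have "((\<lambda>k. v k p) has_sum V p) UNIV"
      by (rule h2_has_sum_eval[OF V True])
    ultimately show ?thesis unfolding v_def mult.assoc by (metis has_sum_unique)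
  next
    case False
    moreover have "V \<in> hardy2" using V by (simp add: h2_has_sum_def)
    ultimately show ?thesis using h by (simp add: hardy2_outside del: mem_Times_iff)
  qed
  hence "V = (\<lambda>p. szego2 q p * h p)" by blast
  with V show ?thesis by (simp add: v_def[abs_def])
qed

lemma szego2_mult_hardy2:
  "h \<in> hardy2 \<Longrightarrow> q \<in> bidisk \<Longrightarrow> (\<lambda>p. szego2 q p * h p) \<in> hardy2"
  using h2_has_sum_szego2_mult by (auto simp: h2_has_sum_def)

lemma h2_submoduleD:
  assumes "h2_submodule M"
  shows h2_submodule_hardy2: "f \<in> M \<Longrightarrow> f \<in> hardy2"
    and h2_submodule_zero: "(\<lambda>p. 0) \<in> M"
    and h2_submodule_add: "f \<in> M \<Longrightarrow> g \<in> M \<Longrightarrow> (\<lambda>p. f p + g p) \<in> M"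
    and h2_submodule_cmult: "f \<in> M \<Longrightarrow> (\<lambda>p. c * f p) \<in> M"
    and h2_submodule_closure: "f \<in> h2_closure M \<Longrightarrow> f \<in> M"
    and h2_submodule_fst: "f \<in> M \<Longrightarrow> (\<lambda>p. fst p * f p) \<in> M"
    and h2_submodule_snd: "f \<in> M \<Longrightarrow> (\<lambda>p. snd p * f p) \<in> M"
  using assms unfolding h2_submodule_def h2_closed_subspace_def case_prod_unfold prod.collapse
  by blast+

lemma h2_submodule_monom2_mult:
  assumes M: "h2_submodule M" and f: "f \<in> M"
  shows "(\<lambda>p. monom2 p k * f p) \<in> M"
proof -
  have fst: "(\<lambda>p. fst p ^ m * g p) \<in> M" if "g \<in> M" for g m
    using that h2_submodule_fst[OF M] by (induction m) (force simp: mult.assoc)+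
  have snd: "(\<lambda>p. snd p ^ m * g p) \<in> M" if "g \<in> M" for g m
    using that h2_submodule_snd[OF M] by (induction m) (force simp: mult.assoc)+
  show ?thesis using fst[OF snd[OF f]] by (simp add: monom2_def mult.assoc)
qed

text \<open>The partial sums of \<open>h2_has_sum_szego2_mult\<close> lie in the submodule, which is closed.\<close>

lemma h2_submodule_szego2_mult:
  assumes M: "h2_submodule M" and f: "f \<in> M" and q: "q \<in> bidisk"
  shows "(\<lambda>p. szego2 q p * f p) \<in> M"
proof (rule h2_submodule_closure[OF M],
    rule h2_has_sum_in_closure[OF h2_has_sum_szego2_mult[OF h2_submodule_hardy2[OF M f] q]])
  fix S :: "(nat \<times> nat) set" assume "finite S"
  thus "(\<lambda>p. \<Sum>k\<in>S. cnj (monom2 q k) * (monom2 p k * f p)) \<in> M"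
    by (induction S rule: finite_induct)
       (auto intro!: h2_submodule_zero h2_submodule_add h2_submodule_cmult h2_submodule_monom2_mult M f)
qed

lemma comp_op_apply: "comp_op \<theta> \<phi> f p = (if p \<in> bidisk then f (\<theta> (fst p), \<phi> (snd p)) else 0)"
  by (cases p) (simp add: comp_op_def)

section \<open>Lifting through a pair of inner functions\<close>

locale inner_pair =
  fixes \<theta> \<phi> :: "complex \<Rightarrow> complex"
  assumes inner: "inner_function \<theta>" "inner_function \<phi>"
    and nonconst: "\<not> \<theta> constant_on disk" "\<not> \<phi> constant_on disk"
begin

definition inner_map :: "complex \<times> complex \<Rightarrow> complex \<times> complex" where
  "inner_map p = (\<theta> (fst p), \<phi> (snd p))"

lemma inner_map_bidisk: "p \<in> bidisk \<Longrightarrow> inner_map p \<in> bidisk"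
  using inner_function_maps_disk[OF inner(1) nonconst(1)] inner_function_maps_disk[OF inner(2) nonconst(2)]
  unfolding inner_map_def mem_Times_iff by simp

definition model_kernel2 :: "complex \<times> complex \<Rightarrow> complex \<times> complex \<Rightarrow> complex" where
  "model_kernel2 q p = model_kernel \<theta> (fst q) (fst p) * model_kernel \<phi> (snd q) (snd p)"

lemma model_kernel2_cnj: "cnj (model_kernel2 q p) = model_kernel2 p q"
  by (simp add: model_kernel2_def model_kernel_cnj)

text \<open>The product of the kernel \<open>model_kernel2 q\<close> with the k-th monomial in \<open>\<theta>(z)\<close> and \<open>\<phi>(w)\<close>. For fixed q these
  functions are orthogonal with a common norm, being in different shifts of the wandering
  subspace.\<close>

definition wandering :: "complex \<times> complex \<Rightarrow> nat \<times> nat \<Rightarrow> complex \<times> complex \<Rightarrow> complex" where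
  "wandering q k = tens (\<lambda>z. \<theta> z ^ fst k * model_kernel \<theta> (fst q) z) (\<lambda>w. \<phi> w ^ snd k * model_kernel \<phi> (snd q) w)"

text \<open>For fixed q this is a multiple of an isometry, in contrast to the composition operator alone,
  which is isometric only if \<theta> and \<phi> vanish at the origin.\<close>

definition lift :: "complex \<times> complex \<Rightarrow> (complex \<times> complex \<Rightarrow> complex) \<Rightarrow> complex \<times> complex \<Rightarrow> complex" where
  "lift q g p = model_kernel2 q p * comp_op \<theta> \<phi> g p"

lemma bdd_holo_wandering:
  assumes "q \<in> bidisk"
  shows "bdd_holo (\<lambda>z. \<theta> z ^ m * model_kernel \<theta> (fst q) z)" "bdd_holo (\<lambda>w. \<phi> w ^ m * model_kernel \<phi> (snd q) w)"
  using assms unfolding mem_Times_iff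
  by (intro bdd_holo_mult bdd_holo_power bdd_holo_model_kernel inner inner[THEN inner_function_bdd_holo]; simp)+

lemma wandering_hardy2: "q \<in> bidisk \<Longrightarrow> wandering q k \<in> hardy2"
  unfolding wandering_def by (intro tens_hardy2 bdd_holo_wandering)

lemma wandering_apply: "p \<in> bidisk \<Longrightarrow> wandering q k p = monom2 (inner_map p) k * model_kernel2 q p"
  by (cases p) (simp add: wandering_def tens_def monom2_def inner_map_def model_kernel2_def mult_ac)

lemma wandering_inner:
  assumes "q \<in> bidisk" "q' \<in> bidisk"
  shows "h2_inner (wandering q k) (wandering q' k') = (if k = k' then model_kernel2 q q' else 0)"
  unfolding wandering_def h2_inner_tens[OF bdd_holo_wandering[OF assms(1)] bdd_holo_wandering[OF assms(2)]]
  using assms model_kernel_gram[OF inner(1), of "fst q" "fst q'" "fst k" "fst k'"]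
    model_kernel_gram[OF inner(2), of "snd q" "snd q'" "snd k" "snd k'"]
  by (auto simp: model_kernel2_def prod_eq_iff mem_Times_iff)

text \<open>Substituting \<open>(\<theta>, \<phi>)\<close> into the expansion of g gives an orthogonal series whose coefficients are
  square summable.\<close>

lemma h2_has_sum_lift:
  assumes g: "g \<in> hardy2" and q: "q \<in> bidisk"
  shows "h2_has_sum (\<lambda>k p. coeffs2 g k * wandering q k p) (lift q g)"
proof -
  define v where "v k p = coeffs2 g k * wandering q k p" for k p
  have v: "v k \<in> hardy2" for k
    unfolding v_def[abs_def] by (intro hardy2_cmult wandering_hardy2 q)
  have bound: "(h2_norm (\<lambda>p. \<Sum>k\<in>S. v k p))\<^sup>2 \<le> (\<Sum>k\<in>S. (cmod (coeffs2 g k))\<^sup>2 * Re (model_kernel2 q q))"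
    if S: "finite S" for S
  proof -
    define W where "W p = (\<Sum>k\<in>S. v k p)" for p
    have W: "W \<in> hardy2" unfolding W_def[abs_def] by (intro hardy2_sum v)
    have W_inner: "h2_inner W y = (\<Sum>k\<in>S. coeffs2 g k * h2_inner (wandering q k) y)"
      if "y \<in> hardy2" for y
      unfolding W_def[abs_def] using v wandering_hardy2[OF q] that
      by (subst h2_inner_sum_left) (auto simp: v_def[abs_def] h2_inner_cmult_left)
    have Wj: "h2_inner W (wandering q j) = coeffs2 g j * model_kernel2 q q" if "j \<in> S" for j
    proof -
      have "h2_inner W (wandering q j) = (\<Sum>k\<in>S. coeffs2 g k * h2_inner (wandering q k) (wandering q j))"
        by (rule W_inner[OF wandering_hardy2[OF q]])
      also have "\<dots> = (\<Sum>k\<in>S. if k = j then coeffs2 g k * model_kernel2 q q else 0)"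
        by (intro sum.cong refl) (simp add: wandering_inner q)
      also have "\<dots> = coeffs2 g j * model_kernel2 q q" using S that by simp
      finally show ?thesis .
    qed
    have "h2_inner W W = (\<Sum>k\<in>S. coeffs2 g k * h2_inner (wandering q k) W)"
      by (rule W_inner[OF W])
    also have "\<dots> = (\<Sum>k\<in>S. of_real ((cmod (coeffs2 g k))\<^sup>2) * model_kernel2 q q)"
    proof (rule sum.cong[OF refl])
      fix k assume "k \<in> S"
      have "h2_inner (wandering q k) W = cnj (coeffs2 g k) * model_kernel2 q q"
        using h2_inner_commute[of "wandering q k" W] by (simp add: Wj[OF \<open>k \<in> S\<close>] model_kernel2_cnj)
      thus "coeffs2 g k * h2_inner (wandering q k) W = of_real ((cmod (coeffs2 g k))\<^sup>2) * model_kernel2 q q"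
        unfolding complex_norm_square by (simp add: mult.assoc)
    qed
    finally have "Re (h2_inner W W) = (\<Sum>k\<in>S. (cmod (coeffs2 g k))\<^sup>2 * Re (model_kernel2 q q))"
      by (simp only: Re_sum Re_complex_of_real times_complex.sel Im_complex_of_real) simp
    thus ?thesis using h2_norm_sq[OF W] unfolding W_def[abs_def] by simp
  qed
  obtain V where V: "h2_has_sum v V"
    by (rule h2_series_converges[OF v _ bound])
       (intro summable_on_cmult_left coeffs2_square_summable g)
  have "V p = lift q g p" for p
  proof (cases "p \<in> bidisk")
    case True
    have "((\<lambda>k. coeffs2 g k * monom2 (inner_map p) k * model_kernel2 q p) has_sum g (inner_map p) * model_kernel2 q p) UNIV"
      by (intro has_sum_cmult_left coeffs2_has_sum g inner_map_bidisk True)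
    moreover have "((\<lambda>k. v k p) has_sum V p) UNIV"
      by (rule h2_has_sum_eval[OF V True])
    moreover have "v k p = coeffs2 g k * monom2 (inner_map p) k * model_kernel2 q p" for k
      by (simp only: v_def wandering_apply[OF True] mult.assoc)
    ultimately have "V p = g (inner_map p) * model_kernel2 q p"
      by (metis (no_types, lifting) has_sum_cong has_sum_unique)
    also have "\<dots> = lift q g p"
      unfolding lift_def comp_op_apply inner_map_def using True by (simp only: if_True mult.commute)
    finally show ?thesis .
  next
    case False
    have "V \<in> hardy2" using V by (simp add: h2_has_sum_def)
    hence "V p = 0" using False by (rule hardy2_outside)
    thus ?thesis using False unfolding lift_def comp_op_apply by (simp only: if_False mult_zero_right)
  qed
  hence "V = lift q g" by blast
  with V show ?thesis by (simp add: v_def[abs_def])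
qed

lemma lift_hardy2: "g \<in> hardy2 \<Longrightarrow> q \<in> bidisk \<Longrightarrow> lift q g \<in> hardy2"
  using h2_has_sum_lift by (auto simp: h2_has_sum_def)

text \<open>Expanding both arguments along \<open>wandering\<close> leaves the diagonal terms only.\<close>

lemma lift_inner:
  assumes g: "g \<in> hardy2" and h: "h \<in> hardy2" and q: "q \<in> bidisk" and q': "q' \<in> bidisk"
  shows "h2_inner (lift q g) (lift q' h) = model_kernel2 q q' * h2_inner g h"
proof -
  note H = lift_hardy2[OF h q']
  have wl: "h2_inner (wandering q k) (lift q' h) = cnj (coeffs2 h k) * model_kernel2 q q'" for k
  proof -
    have "((\<lambda>j. h2_inner (\<lambda>p. coeffs2 h j * wandering q' j p) (wandering q k)) has_sum h2_inner (lift q' h) (wandering q k)) UNIV"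
      by (rule h2_has_sum_inner[OF h2_has_sum_lift[OF h q'] wandering_hardy2[OF q]])
    moreover have "h2_inner (\<lambda>p. coeffs2 h j * wandering q' j p) (wandering q k) = (if j = k then coeffs2 h k * model_kernel2 q' q else 0)" for j
      by (simp add: h2_inner_cmult_left wandering_hardy2 q q' wandering_inner)
    moreover have "((\<lambda>j. if j = k then coeffs2 h k * model_kernel2 q' q else 0) has_sum coeffs2 h k * model_kernel2 q' q) UNIV"
      by (rule has_sum_finite_neutralI[of "{k}"]) auto
    ultimately have "h2_inner (lift q' h) (wandering q k) = coeffs2 h k * model_kernel2 q' q"
      by (simp only: has_sum_unique)
    thus ?thesis using h2_inner_commute[of "wandering q k" "lift q' h"] by (simp add: model_kernel2_cnj)
  qed
  have "((\<lambda>k. h2_inner (\<lambda>p. coeffs2 g k * wandering q k p) (lift q' h)) has_sum h2_inner (lift q g) (lift q' h)) UNIV"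
    by (rule h2_has_sum_inner[OF h2_has_sum_lift[OF g q] H])
  moreover have "h2_inner (\<lambda>p. coeffs2 g k * wandering q k p) (lift q' h) = model_kernel2 q q' * (coeffs2 g k * cnj (coeffs2 h k))" for k
    by (simp add: h2_inner_cmult_left[OF wandering_hardy2[OF q] H] wl)
  moreover have "((\<lambda>k. model_kernel2 q q' * (coeffs2 g k * cnj (coeffs2 h k))) has_sum model_kernel2 q q' * h2_inner g h) UNIV"
    by (intro has_sum_cmult_right h2_inner_has_sum g h)
  ultimately show ?thesis by (simp only: has_sum_unique)
qed

text \<open>The factor \<open>1 - cnj (\<theta> a) * \<theta> z\<close> in the numerator of the model space kernel cancels against the
  Szego kernel at the image points.\<close>

lemma szego2_eq_model_kernel2:
  assumes "q \<in> bidisk" "p \<in> bidisk"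
  shows "szego2 q p = model_kernel2 q p * szego2 (inner_map q) (inner_map p)"
proof -
  have 1: "szego a z = model_kernel \<psi> a z * szego (\<psi> a) (\<psi> z)"
    if "\<psi> a \<in> disk" "\<psi> z \<in> disk" for \<psi> a z
    using szego_denom(2)[OF that] by (simp add: model_kernel_eq szego_def)
  have 2: "szego2 q p = szego (fst q) (fst p) * szego (snd q) (snd p)" if "p \<in> bidisk" for q p
    using that by (cases p) (simp add: szego2_def tens_def)
  have "inner_map q \<in> bidisk" "inner_map p \<in> bidisk" using assms by (simp_all only: inner_map_bidisk)
  thus ?thesis
    unfolding 2[OF assms(2)] 2[OF \<open>inner_map p \<in> bidisk\<close>] model_kernel2_def
    using 1[of \<theta> "fst q" "fst p"] 1[of \<phi> "snd q" "snd p"]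
    unfolding inner_map_def mem_Times_iff fst_conv snd_conv by (simp only: mult_ac)
qed

lemma szego2_mult_comp_op:
  assumes "q \<in> bidisk"
  shows "(\<lambda>p. szego2 q p * comp_op \<theta> \<phi> f p) = lift q (\<lambda>p. szego2 (inner_map q) p * f p)"
proof
  fix p
  show "szego2 q p * comp_op \<theta> \<phi> f p = lift q (\<lambda>p. szego2 (inner_map q) p * f p) p"
    using szego2_eq_model_kernel2[OF assms, of p]
    unfolding lift_def comp_op_apply inner_map_def by (simp only: mult.assoc mult_zero_right split: if_split) simp
qed

text \<open>The Szego kernel at the origin is 1, so the composition is a lift of an element of the Hardy
  space.\<close>

lemma comp_op_hardy2:
  assumes "f \<in> hardy2"
  shows "comp_op \<theta> \<phi> f \<in> hardy2"
proof -
  have 0: "(0, 0) \<in> bidisk" by simp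
  have "comp_op \<theta> \<phi> f p = szego2 (0, 0) p * comp_op \<theta> \<phi> f p" for p
    by (cases p) (auto simp: szego2_def tens_def szego_def comp_op_def)
  hence "comp_op \<theta> \<phi> f = lift (0, 0) (\<lambda>p. szego2 (inner_map (0, 0)) p * f p)"
    using szego2_mult_comp_op[OF 0, of f] by presburger
  thus ?thesis by (simp only: lift_hardy2 szego2_mult_hardy2 inner_map_bidisk 0 assms)
qed

lemma monomials_sum_in_poly_span:
  assumes "f \<in> X" "finite S"
  shows "(\<lambda>p. \<Sum>k\<in>S. c k * (monom2 p k * f p)) \<in> poly_span X"
proof -
  define d where "d = Max (insert 0 (fst ` S \<union> snd ` S))"
  have S: "S \<subseteq> {..d} \<times> {..d}"
    unfolding d_def using assms(2) by (force intro!: Max_ge)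
  define r where "r = (\<lambda>(z, w). \<Sum>i\<le>d. \<Sum>j\<le>d. (if (i, j) \<in> S then c (i, j) else 0) * z ^ i * w ^ j)"
  have "r \<in> bipolys"
    unfolding bipolys_def r_def by (auto intro!: exI[of _ d] exI[of _ "\<lambda>i j. if (i, j) \<in> S then c (i, j) else 0"])
  moreover have "(\<Sum>k\<in>S. c k * (monom2 p k * f p)) = r p * f p" for p
  proof -
    have "r p = (\<Sum>k\<in>{..d} \<times> {..d}. (if k \<in> S then c k else 0) * monom2 p k)"
      by (cases p) (auto simp: r_def sum.cartesian_product monom2_def mult.assoc intro!: sum.cong)
    also have "\<dots> = (\<Sum>k\<in>S. c k * monom2 p k)"
      by (rule sum.mono_neutral_cong_right) (use S in auto)
    finally show ?thesis by (simp add: sum_distrib_right mult.assoc)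
  qed
  ultimately show ?thesis
    unfolding poly_span_def
    by (intro CollectI exI[of _ 1] exI[of _ "\<lambda>_. r"] exI[of _ "\<lambda>_. f"]) (use assms in auto)
qed

text \<open>Write \<open>g = S f\<close>, where S is the Szego kernel at the image of q; then f arises from g by polynomial
  multiplication, so it lies in M, and the lift of g is the Szego kernel at q times the composed f,
  a norm limit of polynomial multiples.\<close>

lemma lift_in_generated_submodule:
  assumes M: "h2_submodule M" and g: "g \<in> M" and q: "q \<in> bidisk"
  shows "lift q g \<in> generated_submodule (comp_op \<theta> \<phi> ` M)"
proof -
  \<comment> \<open>The factors \<open>1 - a z\<close> and \<open>1 - b w\<close>, applied one after the other, invert the Szego kernel at \<open>inner_map q\<close>.\<close>
  define a where "a = cnj (fst (inner_map q))"
  define b where "b = cnj (snd (inner_map q))"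
  define h where "h p = g p + - a * (fst p * g p)" for p
  define f where "f p = h p + - b * (snd p * h p)" for p
  have "h \<in> M" unfolding h_def[abs_def]
    by (intro h2_submodule_add h2_submodule_cmult h2_submodule_fst M g)
  hence f: "f \<in> M" unfolding f_def[abs_def]
    by (intro h2_submodule_add h2_submodule_cmult h2_submodule_snd M)
  have g_eq: "g p = szego2 (inner_map q) p * f p" if p: "p \<in> bidisk" for p
  proof -
    have "f p = (1 - a * fst p) * (1 - b * snd p) * g p"
      by (simp add: f_def h_def algebra_simps)
    moreover have "szego2 (inner_map q) p = 1 / ((1 - a * fst p) * (1 - b * snd p))"
      using p by (cases p) (simp add: szego2_def tens_def szego_def a_def b_def)
    moreover have "1 - a * fst p \<noteq> 0" "1 - b * snd p \<noteq> 0"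
      unfolding a_def b_def using inner_map_bidisk[OF q] p
      by (intro szego_denom(2); simp only: mem_Times_iff)+
    ultimately show ?thesis by simp
  qed
  have "lift q g p = lift q (\<lambda>p. szego2 (inner_map q) p * f p) p" for p
    using g_eq[OF inner_map_bidisk[of p]] unfolding lift_def comp_op_apply inner_map_def by presburger
  hence "lift q g = lift q (\<lambda>p. szego2 (inner_map q) p * f p)" by blast
  also have "\<dots> = (\<lambda>p. szego2 q p * comp_op \<theta> \<phi> f p)"
    by (rule szego2_mult_comp_op[OF q, symmetric])
  also have "\<dots> \<in> h2_closure (poly_span (comp_op \<theta> \<phi> ` M))"
    by (rule h2_has_sum_in_closure[OF h2_has_sum_szego2_mult[OF comp_op_hardy2 q]])
       (use M f in \<open>auto intro!: h2_submodule_hardy2 monomials_sum_in_poly_span\<close>)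
  finally show ?thesis by (simp add: generated_submodule_def)
qed

section \<open>The reproducing kernel of the generated submodule\<close>

context
  fixes M K
  assumes M: "h2_submodule M" and K: "reproducing_kernel M K"
begin

lemma kernel_mem: "q \<in> bidisk \<Longrightarrow> K q \<in> M"
  and kernel_inner: "q \<in> bidisk \<Longrightarrow> f \<in> M \<Longrightarrow> h2_inner f (K q) = f q"
  using K by (auto simp: reproducing_kernel_def)

text \<open>The right-hand side of the kernel formula, as a function that vanishes outside the bidisk.\<close>

definition lifted_kernel :: "complex \<times> complex \<Rightarrow> complex \<times> complex \<Rightarrow> complex" where
  "lifted_kernel q = lift q (K (inner_map q))"

lemma lifted_kernel_hardy2: "q \<in> bidisk \<Longrightarrow> lifted_kernel q \<in> hardy2"
  unfolding lifted_kernel_def by (intro lift_hardy2 h2_submodule_hardy2[OF M] kernel_mem inner_map_bidisk)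

text \<open>The pairing of \<open>lifted_kernel q\<close> with \<open>szego2 \<alpha> \<cdot> C\<close>, where C is the composed f, is computed in two ways: by
  \<open>lift_inner\<close> and the reproducing property of K, and by expanding \<open>szego2 \<alpha>\<close> into monomials. As \<alpha>
  varies, uniqueness of power series coefficients isolates the individual monomials.\<close>

lemma inner_monomial_lifted_kernel:
  assumes f: "f \<in> M" and q: "q \<in> bidisk"
  shows "h2_inner (\<lambda>p. monom2 p k * comp_op \<theta> \<phi> f p) (lifted_kernel q) = monom2 q k * comp_op \<theta> \<phi> f q"
proof -
  define C where "C = comp_op \<theta> \<phi> f"
  note fh = h2_submodule_hardy2[OF M f]
  have C: "C \<in> hardy2" unfolding C_def by (rule comp_op_hardy2[OF fh])
  define A where "A k = h2_inner (\<lambda>p. monom2 p k * C p) (lifted_kernel q)" for k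
  define B where "B k = monom2 q k * C q" for k
  \<comment> \<open>The kernel is antianalytic in its parameter; conjugating the parameter makes G a power series.\<close>
  define G where "G = (\<lambda>(z, w). szego2 (cnj z, cnj w) q * C q)"
  have cnj_monom2: "cnj (monom2 (cnj z, cnj w) k) = z ^ fst k * w ^ snd k" for z w k
    by (simp add: monom2_def)
  have repr: "h2_inner (\<lambda>p. szego2 \<alpha> p * C p) (lifted_kernel q) = szego2 \<alpha> q * C q" if \<alpha>: "\<alpha> \<in> bidisk" for \<alpha>
  proof -
    have sf: "(\<lambda>p. szego2 (inner_map \<alpha>) p * f p) \<in> M"
      by (intro h2_submodule_szego2_mult M f inner_map_bidisk \<alpha>)
    have "h2_inner (\<lambda>p. szego2 \<alpha> p * C p) (lifted_kernel q) =
        model_kernel2 \<alpha> q * h2_inner (\<lambda>p. szego2 (inner_map \<alpha>) p * f p) (K (inner_map q))"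
      unfolding C_def szego2_mult_comp_op[OF \<alpha>] lifted_kernel_def
      by (intro lift_inner h2_submodule_hardy2[OF M] sf kernel_mem inner_map_bidisk q \<alpha>)
    also have "\<dots> = model_kernel2 \<alpha> q * (szego2 (inner_map \<alpha>) (inner_map q) * f (inner_map q))"
      by (simp only: kernel_inner[OF inner_map_bidisk[OF q] sf])
    also have "\<dots> = szego2 \<alpha> q * C q"
      unfolding C_def comp_op_apply szego2_eq_model_kernel2[OF \<alpha> q] using q by (simp only: inner_map_def mult.assoc if_True)
    finally show ?thesis .
  qed
  have 1: "((\<lambda>(m, n). A (m, n) * z ^ m * w ^ n) has_sum G (z, w)) UNIV" if "z \<in> disk" "w \<in> disk" for z w
  proof -
    have \<alpha>: "(cnj z, cnj w) \<in> bidisk" using that by simp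
    have "((\<lambda>k. h2_inner (\<lambda>p. cnj (monom2 (cnj z, cnj w) k) * (monom2 p k * C p)) (lifted_kernel q))
        has_sum szego2 (cnj z, cnj w) q * C q) UNIV"
      using h2_has_sum_inner[OF h2_has_sum_szego2_mult[OF C \<alpha>] lifted_kernel_hardy2[OF q]] unfolding repr[OF \<alpha>] .
    hence "((\<lambda>k. cnj (monom2 (cnj z, cnj w) k) * A k) has_sum szego2 (cnj z, cnj w) q * C q) UNIV"
      by (simp only: h2_inner_cmult_left[OF monom2_mult_hardy2[OF C] lifted_kernel_hardy2[OF q]] A_def)
    thus ?thesis
      by (simp add: cnj_monom2 G_def case_prod_unfold mult_ac)
  qed
  have 2: "((\<lambda>(m, n). B (m, n) * z ^ m * w ^ n) has_sum G (z, w)) UNIV" if "z \<in> disk" "w \<in> disk" for z w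
  proof -
    have \<alpha>: "(cnj z, cnj w) \<in> bidisk" using that by simp
    have "((\<lambda>k. cnj (monom2 (cnj z, cnj w) k) * monom2 q k * C q) has_sum szego2 (cnj z, cnj w) q * C q) UNIV"
      by (intro has_sum_cmult_left szego2_has_sum \<alpha> q)
    thus ?thesis
      by (simp add: cnj_monom2 B_def G_def case_prod_unfold mult_ac)
  qed
  have "A (m, n) = B (m, n)" for m n
    using taylor_coeff_unique[of "\<lambda>m n. A (m, n)" G m n, OF 1] taylor_coeff_unique[of "\<lambda>m n. B (m, n)" G m n, OF 2]
    by simp
  hence "A k = B k" by (cases k) simp
  thus ?thesis by (simp add: A_def B_def C_def)
qed

lemma poly_mult_comp_op:
  assumes r: "r \<in> bipolys" and f: "f \<in> M" and q: "q \<in> bidisk"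
  shows "(\<lambda>p. r p * comp_op \<theta> \<phi> f p) \<in> hardy2"
    and "h2_inner (\<lambda>p. r p * comp_op \<theta> \<phi> f p) (lifted_kernel q) = r q * comp_op \<theta> \<phi> f q"
proof -
  define C where "C = comp_op \<theta> \<phi> f"
  have C: "C \<in> hardy2" unfolding C_def by (rule comp_op_hardy2[OF h2_submodule_hardy2[OF M f]])
  obtain d c where r: "r = (\<lambda>(z, w). \<Sum>i\<le>d. \<Sum>j\<le>d. c i j * z ^ i * w ^ j)"
    using r by (auto simp: bipolys_def)
  have eq: "r p * C p = (\<Sum>k\<in>{..d} \<times> {..d}. c (fst k) (snd k) * (monom2 p k * C p))" for p
    by (cases p) (simp add: r sum.cartesian_product sum_distrib_right monom2_def mult.assoc case_prod_unfold)
  have h: "(\<lambda>p. c (fst k) (snd k) * (monom2 p k * C p)) \<in> hardy2" for k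
    by (intro hardy2_cmult monom2_mult_hardy2 C)
  show "(\<lambda>p. r p * comp_op \<theta> \<phi> f p) \<in> hardy2"
    unfolding C_def[symmetric] eq by (intro hardy2_sum h)
  have "h2_inner (\<lambda>p. r p * C p) (lifted_kernel q) =
      (\<Sum>k\<in>{..d} \<times> {..d}. h2_inner (\<lambda>p. c (fst k) (snd k) * (monom2 p k * C p)) (lifted_kernel q))"
    unfolding eq by (intro h2_inner_sum_left h lifted_kernel_hardy2 q)
  also have "\<dots> = (\<Sum>k\<in>{..d} \<times> {..d}. c (fst k) (snd k) * (monom2 q k * C q))"
    unfolding C_def using monom2_mult_hardy2[OF C] lifted_kernel_hardy2[OF q]
    by (intro sum.cong refl) (simp only: h2_inner_cmult_left inner_monomial_lifted_kernel[OF f q] C_def)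
  finally show "h2_inner (\<lambda>p. r p * comp_op \<theta> \<phi> f p) (lifted_kernel q) = r q * comp_op \<theta> \<phi> f q"
    by (simp only: C_def[symmetric] eq)
qed

lemma poly_span_comp_op:
  assumes g: "g \<in> poly_span (comp_op \<theta> \<phi> ` M)" and q: "q \<in> bidisk"
  shows "g \<in> hardy2" and "h2_inner g (lifted_kernel q) = g q"
proof -
  obtain N :: nat and r F where rF: "\<And>k. k < N \<Longrightarrow> r k \<in> bipolys \<and> F k \<in> comp_op \<theta> \<phi> ` M"
    and g: "g = (\<lambda>p. \<Sum>k<N. r k p * F k p)"
    using g by (auto simp: poly_span_def)
  have *: "(\<lambda>p. r k p * F k p) \<in> hardy2 \<and> h2_inner (\<lambda>p. r k p * F k p) (lifted_kernel q) = r k q * F k q"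
    if k: "k < N" for k
  proof -
    obtain f where "f \<in> M" "F k = comp_op \<theta> \<phi> f" using rF[OF k] by blast
    thus ?thesis using poly_mult_comp_op[of "r k" f q] rF[OF k] q by simp
  qed
  show "g \<in> hardy2" unfolding g by (rule hardy2_sum) (use * in simp)
  show "h2_inner g (lifted_kernel q) = g q"
    unfolding g by (subst h2_inner_sum_left) (use * lifted_kernel_hardy2[OF q] in auto)
qed

text \<open>Both \<open>f \<mapsto> \<langle>f, lifted_kernel q\<rangle>\<close> and evaluation at q are continuous, and they agree on a dense subspace.\<close>

lemma lifted_kernel_reproducing:
  assumes f: "f \<in> generated_submodule (comp_op \<theta> \<phi> ` M)" and q: "q \<in> bidisk"
  shows "h2_inner f (lifted_kernel q) = f q"
proof (rule ccontr)
  assume ne: "h2_inner f (lifted_kernel q) \<noteq> f q"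
  note k = lifted_kernel_hardy2[OF q] and s = szego2_hardy2[OF q]
  \<comment> \<open>The summand 1 only ensures that c is positive.\<close>
  define c where "c = h2_norm (lifted_kernel q) + h2_norm (szego2 q) + 1"
  have c: "c > 0" using h2_norm_nonneg[OF k] h2_norm_nonneg[OF s] by (simp add: c_def)
  \<comment> \<open>An approximation within e moves both functionals by less than their supposed difference.\<close>
  define e where "e = cmod (h2_inner f (lifted_kernel q) - f q) / c"
  have "e > 0" using ne c by (simp add: e_def)
  then obtain g where g: "g \<in> poly_span (comp_op \<theta> \<phi> ` M)" and ge: "h2_norm (\<lambda>p. f p - g p) < e"
    and fh: "f \<in> hardy2"
    using f unfolding generated_submodule_def h2_closure_def by blast
  note gh = poly_span_comp_op(1)[OF g q]
  have d: "(\<lambda>p. f p - g p) \<in> hardy2" by (rule hardy2_diff[OF fh gh])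
  have "h2_inner f (lifted_kernel q) - f q = h2_inner (\<lambda>p. f p - g p) (lifted_kernel q) - h2_inner (\<lambda>p. f p - g p) (szego2 q)"
    by (simp add: h2_inner_szego2[OF d q] h2_inner_diff_left fh gh k poly_span_comp_op(2)[OF g q])
  hence "cmod (h2_inner f (lifted_kernel q) - f q) \<le>
      cmod (h2_inner (\<lambda>p. f p - g p) (lifted_kernel q)) + cmod (h2_inner (\<lambda>p. f p - g p) (szego2 q))"
    using norm_triangle_ineq4 by metis
  also have "\<dots> \<le> h2_norm (\<lambda>p. f p - g p) * h2_norm (lifted_kernel q) + h2_norm (\<lambda>p. f p - g p) * h2_norm (szego2 q)"
    by (intro add_mono h2_cauchy_schwarz d k s)
  also have "\<dots> \<le> h2_norm (\<lambda>p. f p - g p) * c"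
    using h2_norm_nonneg[OF d] by (simp add: c_def distrib_left)
  also have "\<dots> < e * c" using ge c by simp
  finally show False using c by (simp add: e_def)
qed

lemma lifted_kernel_symmetric:
  assumes "p \<in> bidisk" "q \<in> bidisk"
  shows "cnj (lifted_kernel q p) = lifted_kernel p q"
proof -
  have "cnj (K (inner_map q) (inner_map p)) = K (inner_map p) (inner_map q)"
    using h2_inner_commute[of "K (inner_map q)" "K (inner_map p)"]
    unfolding kernel_inner[OF inner_map_bidisk[OF assms(1)] kernel_mem[OF inner_map_bidisk[OF assms(2)]]]
      kernel_inner[OF inner_map_bidisk[OF assms(2)] kernel_mem[OF inner_map_bidisk[OF assms(1)]]]
    by simp
  thus ?thesis
    using assms unfolding lifted_kernel_def lift_def comp_op_apply
    by (simp only: if_True complex_cnj_mult model_kernel2_cnj inner_map_def)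
qed

text \<open>Two kernels that reproduce the same space and lie in it coincide, by pairing them with each
  other.\<close>

lemma lifted_kernel_unique:
  assumes K': "reproducing_kernel (generated_submodule (comp_op \<theta> \<phi> ` M)) K'"
    and p: "p \<in> bidisk" and q: "q \<in> bidisk"
  shows "K' p q = lifted_kernel p q"
proof -
  have mem: "K' p \<in> generated_submodule (comp_op \<theta> \<phi> ` M)"
    using K' p unfolding reproducing_kernel_def by blast
  have kmem: "lifted_kernel q \<in> generated_submodule (comp_op \<theta> \<phi> ` M)"
    unfolding lifted_kernel_def by (intro lift_in_generated_submodule M kernel_mem inner_map_bidisk q)
  have "K' p q = h2_inner (K' p) (lifted_kernel q)" by (simp only: lifted_kernel_reproducing[OF mem q])
  also have "\<dots> = cnj (h2_inner (lifted_kernel q) (K' p))" by (rule h2_inner_commute)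
  also have "h2_inner (lifted_kernel q) (K' p) = lifted_kernel q p"
    using K' p kmem unfolding reproducing_kernel_def by blast
  also have "cnj (lifted_kernel q p) = lifted_kernel p q" by (rule lifted_kernel_symmetric[OF p q])
  finally show ?thesis .
qed

end

end

theorem theorem3p1:
  fixes \<theta> \<phi> :: "complex \<Rightarrow> complex"
    and M :: "(complex \<times> complex \<Rightarrow> complex) set"
    and K K' :: "complex \<times> complex \<Rightarrow> complex \<times> complex \<Rightarrow> complex"
    and l \<mu> z w :: complex
  assumes "inner_function \<theta>" and "\<not> \<theta> constant_on disk"
    and "inner_function \<phi>" and "\<not> \<phi> constant_on disk"
    and "h2_submodule M"
    and "reproducing_kernel M K"
    and "reproducing_kernel (generated_submodule (comp_op \<theta> \<phi> ` M)) K'"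
    and "(l, \<mu>) \<in> bidisk" and "(z, w) \<in> bidisk"
  shows "K' (l, \<mu>) (z, w) =
           (1 - cnj (\<theta> l) * \<theta> z) / (1 - cnj l * z) *
           ((1 - cnj (\<phi> \<mu>) * \<phi> w) / (1 - cnj \<mu> * w)) *
           K (\<theta> l, \<phi> \<mu>) (\<theta> z, \<phi> w)"
proof -
  interpret inner_pair \<theta> \<phi>
    by unfold_locales (use assms in auto)
  have "K' (l, \<mu>) (z, w) = lifted_kernel K (l, \<mu>) (z, w)"
    by (rule lifted_kernel_unique[OF assms(5-9)])
  thus ?thesis
    using assms(9)
    by (simp add: lifted_kernel_def[OF assms(5,6)] lift_def model_kernel2_def model_kernel_eq comp_op_def inner_map_def)
qed

end
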